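(* Let $T>0$, $0<\ell\le L$, let $\eta\in L^\infty(0,T)$ with $\eta\not\equiv 0$, and let $u_0\equiv 0$. For $\Lambda\in\{\ell,L\}$ let $u^\Lambda$ be the solution of \[ \begin{cases} u_t-u_{xx}+uu_x=0, & 0<x<\Lambda,\ 0<t<T,\\ u(0,t)=\eta(t),\quad u(\Lambda,t)=0, & 0<t<T,\\ u(x,0)=u_0(x), & 0<x<\Lambda. \end{cases} \] Assume that for some $M>0$, \[ |u^\ell_x(x,t)|\le M \text{ in } (0,\ell)\times(0,T)\quad\text{and}\quad |u^L_x(x,t)|\le M \text{ in } (0,L)\times(0,T), \] and that $u^\ell_x(0,t)=u^L_x(0,t)$ for $t\in(0,T)$. Then $\ell=L$. *)

theory Defs
  imports "HOL-Analysis.Analysis"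
begin

definition dx :: "(real \<Rightarrow> real \<Rightarrow> real) \<Rightarrow> real \<Rightarrow> real \<Rightarrow> real" where
  "dx u x t = deriv (\<lambda>y. u y t) x"

definition dt :: "(real \<Rightarrow> real \<Rightarrow> real) \<Rightarrow> real \<Rightarrow> real \<Rightarrow> real" where
  "dt u x t = deriv (\<lambda>s. u x s) t"

definition Linfty_on :: "real \<Rightarrow> (real \<Rightarrow> real) \<Rightarrow> bool" where
  "Linfty_on T \<eta> \<longleftrightarrow>
     \<eta> \<in> borel_measurable (restrict_space lebesgue {0<..<T}) \<and>
     (\<exists>B. AE t in lebesgue. t \<in> {0<..<T} \<longrightarrow> \<bar>\<eta> t\<bar> \<le> B)"

definition ae_zero_on :: "real \<Rightarrow> (real \<Rightarrow> real) \<Rightarrow> bool" where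
  "ae_zero_on T \<eta> \<longleftrightarrow> (AE t in lebesgue. t \<in> {0<..<T} \<longrightarrow> \<eta> t = 0)"

definition burgers_solution ::
  "real \<Rightarrow> real \<Rightarrow> (real \<Rightarrow> real) \<Rightarrow> (real \<Rightarrow> real) \<Rightarrow> (real \<Rightarrow> real \<Rightarrow> real) \<Rightarrow> bool" where
  "burgers_solution Lam T \<eta> u0 u \<longleftrightarrow>
     (\<forall>x t. 0 < x \<and> x < Lam \<and> 0 < t \<and> t < T \<longrightarrow>
        (\<lambda>y. u y t) differentiable (at x) \<and>
        (\<lambda>y. dx u y t) differentiable (at x) \<and>
        (\<lambda>s. u x s) differentiable (at t) \<and>
        dt u x t - deriv (\<lambda>y. dx u y t) x + u x t * dx u x t = 0) \<and>
     continuous_on {(x, t). 0 < x \<and> x \<le> Lam \<and> 0 \<le> t \<and> t < T} (\<lambda>(x, t). u x t) \<and>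
     (\<forall>t. 0 < t \<and> t < T \<longrightarrow> u Lam t = 0) \<and>
     (\<forall>x. 0 < x \<and> x < Lam \<longrightarrow> u x 0 = u0 x) \<and>
     (AE t in lebesgue. t \<in> {0<..<T} \<longrightarrow> ((\<lambda>x. u x t) \<longlongrightarrow> \<eta> t) (at_right 0))"

end

theory Submission
  imports Defs
begin

text \<open>
  By the Cole--Hopf transformation, \<open>\<phi> = exp (- P / 2)\<close> with \<open>P(x,t) = \<integral>\<^sub>0\<^sup>t (u\<^sub>x - u\<^sup>2/2)(x,s) ds\<close>
  turns a solution \<open>u\<close> of Burgers' equation with zero initial data into a solution of the heat
  equation. Two solutions with the same Cauchy data at \<open>x = 0\<close> thus give a solution \<open>z\<close> of the heat
  equation with zero initial and zero Cauchy data. Its truncated Laplace transform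
  \<open>g(x) = \<integral>\<^sub>0\<^sup>\<tau> exp(-st) z(x,t) dt\<close> solves \<open>g'' = s g + exp(-s\<tau>) z(x,\<tau>)\<close> with zero Cauchy data, so it is
  \<open>O(exp(-s\<tau> + x\<surd>s))\<close>, and Mikusinski's lemma forces \<open>z = 0\<close>. Hence \<open>u\<^sup>l = u\<^sup>L\<close> on \<open>(0,l)\<close>. If \<open>l < L\<close>,
  then \<open>u\<^sup>L\<close> vanishes at \<open>x = l\<close> and at \<open>x = L\<close>, so on \<open>[l,L]\<close> by the maximum principle, and unique
  continuation from inside \<open>(l,L)\<close> back to \<open>x = 0\<close> gives \<open>u\<^sup>L = 0\<close> and \<open>\<eta> = 0\<close>.

  The derivatives of \<open>u\<close> are only known to exist pointwise. That \<open>u\<^sub>x\<^sub>x\<close> and \<open>u\<^sub>t\<close> are locally bounded,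
  which justifies differentiation under the integral, follows from a doubling-of-variables
  maximum principle for the difference quotients of \<open>u\<close>.
\<close>

section \<open>Doubling of variables\<close>

text \<open>The second derivative exists only at the point itself, so Taylor expansion is replaced
  by the mean value theorem: \<open>f2 > 0\<close> would make \<open>f'\<close> positive just to the
  right of \<open>x\<close> and push \<open>f\<close> above its maximum.\<close>

lemma derivs_at_local_max:
  fixes f f' :: "real \<Rightarrow> real"
  assumes e: "e > 0"
    and f: "\<And>y. \<bar>y - x\<bar> < e \<Longrightarrow> (f has_real_derivative f' y) (at y)"
    and f': "(f' has_real_derivative f2) (at x)"
    and max: "\<And>y. \<bar>y - x\<bar> < e \<Longrightarrow> f y \<le> f x"
  shows "f' x = 0" and "f2 \<le> 0"
proof -
  show f'0: "f' x = 0"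
    by (rule DERIV_local_max[OF f[of x] e]) (use e max in \<open>auto simp: abs_minus_commute\<close>)
  show "f2 \<le> 0"
  proof (rule ccontr)
    assume "\<not> f2 \<le> 0"
    then obtain d where d: "d > 0" "\<And>h. 0 < h \<Longrightarrow> h < d \<Longrightarrow> f' x < f' (x + h)"
      using DERIV_pos_inc_right[OF f'] by (metis not_le)
    define h where "h = min d e / 2"
    have h: "0 < h" "h < d" "h < e" using d e by (auto simp: h_def min_def)
    obtain z where z: "x < z" "z < x + h" "f (x + h) - f x = (x + h - x) * f' z"
      using MVT2[of x "x + h" f f'] h f by (auto simp: abs_if)
    have "f' z > 0" using d(2)[of "z - x"] z h f'0 by simp
    then have "0 < h * f' z" using h by simp
    then have "f (x + h) > f x" using z(3) by simp
    with max[of "x + h"] h show False by simp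
  qed
qed

text \<open>Only earlier times are compared, because the maxima met below may lie at the final
  time.\<close>

lemma deriv_nonneg_at_left_max:
  fixes g :: "real \<Rightarrow> real"
  assumes g: "(g has_real_derivative d) (at t)" and "s0 < t"
    and max: "\<And>s. s0 < s \<Longrightarrow> s < t \<Longrightarrow> g s \<le> g t"
  shows "d \<ge> 0"
proof (rule ccontr)
  assume "\<not> d \<ge> 0"
  then obtain e where e: "e > 0" "\<And>h. 0 < h \<Longrightarrow> h < e \<Longrightarrow> g t < g (t - h)"
    using DERIV_neg_dec_left[OF g] by (metis not_le)
  define h where "h = min e (t - s0) / 2"
  have "0 < h" "h < e" "h < t - s0" using e \<open>s0 < t\<close> by (auto simp: h_def min_def)
  with e(2)[of h] max[of "t - h"] show False by simp
qed

text \<open>A Lipschitz estimate at \<open>x0\<close> for a linear parabolic equation that uses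
  bounds on \<open>w\<close> and the coefficients, but none on derivatives of \<open>w\<close>; it
  is meant for difference quotients with vanishing step. The choice of \<open>N\<close> gives
  \<open>N * \<rho>\<^sup>2 = 2 * W\<close>, so at the lateral boundary the penalty alone offsets
  the oscillation of \<open>w\<close>. \<open>K / (4 * \<rho>)\<close> is the sum of the error terms
  plus 1, and \<open>8 * A * \<rho>\<^sup>2 \<le> 1\<close> lets the transport term use up at most
  half of the concavity \<open>K / (2 * \<rho>)\<close>.\<close>

lemma doubling_estimate:
  fixes w wx wxx a c :: "real \<Rightarrow> real \<Rightarrow> real" and x0 \<rho> A B C W \<tau> :: real
  defines "N \<equiv> 2 * W / \<rho>\<^sup>2"
  defines "K \<equiv> 4 * \<rho> * (4 * N + 4 * N * B * \<rho> + 2 * C * W + 1)"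
  assumes \<rho>: "\<rho> > 0" "8 * A * \<rho>\<^sup>2 \<le> 1"
    and nonneg: "A \<ge> 0" "B \<ge> 0" "C \<ge> 0" "W \<ge> 0"
    and cont: "continuous_on ({x0 - \<rho>..x0 + \<rho>} \<times> {0..\<tau>}) (\<lambda>(x, t). w x t)"
    and w_x: "\<And>x t. \<bar>x - x0\<bar> < \<rho> \<Longrightarrow> 0 < t \<Longrightarrow> t \<le> \<tau> \<Longrightarrow>
        ((\<lambda>y. w y t) has_real_derivative wx x t) (at x)"
    and w_xx: "\<And>x t. \<bar>x - x0\<bar> < \<rho> \<Longrightarrow> 0 < t \<Longrightarrow> t \<le> \<tau> \<Longrightarrow>
        ((\<lambda>y. wx y t) has_real_derivative wxx x t) (at x)"
    and w_t: "\<And>x t. \<bar>x - x0\<bar> < \<rho> \<Longrightarrow> 0 < t \<Longrightarrow> t \<le> \<tau> \<Longrightarrow>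
        ((\<lambda>s. w x s) has_real_derivative wxx x t - a x t * wx x t - c x t * w x t) (at t)"
    and w0: "\<And>x. \<bar>x - x0\<bar> \<le> \<rho> \<Longrightarrow> w x 0 = 0"
    and w: "\<And>x t. \<bar>x - x0\<bar> \<le> \<rho> \<Longrightarrow> 0 \<le> t \<Longrightarrow> t \<le> \<tau> \<Longrightarrow> \<bar>w x t\<bar> \<le> W"
    and a: "\<And>x t. \<bar>x - x0\<bar> < \<rho> \<Longrightarrow> 0 < t \<Longrightarrow> t \<le> \<tau> \<Longrightarrow> \<bar>a x t\<bar> \<le> B"
    and a_lip: "\<And>x y t. \<bar>x - x0\<bar> < \<rho> \<Longrightarrow> \<bar>y - x0\<bar> < \<rho> \<Longrightarrow> 0 < t \<Longrightarrow> t \<le> \<tau> \<Longrightarrow>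
        \<bar>a x t - a y t\<bar> \<le> A * \<bar>x - y\<bar>"
    and c: "\<And>x t. \<bar>x - x0\<bar> < \<rho> \<Longrightarrow> 0 < t \<Longrightarrow> t \<le> \<tau> \<Longrightarrow> \<bar>c x t\<bar> \<le> C"
    and xy: "y \<le> x" "\<bar>x - x0\<bar> \<le> \<rho>" "\<bar>y - x0\<bar> \<le> \<rho>" and t: "0 \<le> t" "t \<le> \<tau>"
  shows "w x t - w y t \<le> K * (x - y) + N * ((x - x0)\<^sup>2 + (y - x0)\<^sup>2)"
proof -
  \<comment> \<open>At a positive maximum of \<open>\<Phi>\<close> over \<open>y \<le> x\<close>, the concave term in \<open>x - y\<close> contributes
    \<open>- K / (2 * \<rho>)\<close> to the two second derivatives, which beats all other terms.\<close>
  define \<Phi> where "\<Phi> x y t = w x t - w y t - K * ((x - y) - (x - y)\<^sup>2 / (8 * \<rho>))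
      - N * ((x - x0)\<^sup>2 + (y - x0)\<^sup>2)" for x y t
  \<comment> \<open>Both points share the time \<open>t\<close>, and on \<open>y \<le> x\<close> the
    modulus is a smooth function of \<open>x - y\<close>. No positive maximum lies on the diagonal,
    since \<open>\<Phi> \<le> 0\<close> there.\<close>
  define S where "S = ({x0 - \<rho>..x0 + \<rho>} \<times> {x0 - \<rho>..x0 + \<rho>} \<times> {0..\<tau>}) \<inter> {(x, y, t). y \<le> x}"
  have N: "N \<ge> 0" and K: "K > 0"
    using \<rho> nonneg by (auto simp: N_def K_def intro!: mult_pos_pos add_nonneg_pos)
  have "closed {(x, y, t::real). y \<le> (x::real)}"
    unfolding case_prod_unfold by (intro closed_Collect_le continuous_intros)
  then have compS: "compact S"
    unfolding S_def by (intro compact_Int_closed compact_Times) auto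
  have inS: "(x, y, t) \<in> S" using xy t by (auto simp: S_def abs_le_iff)
  have contS: "continuous_on S (\<lambda>(x, y, t). \<Phi> x y t)"
  proof -
    have "continuous_on S (\<lambda>p. w (fst p) (snd (snd p)))"
      using continuous_on_compose2[OF cont, of S "\<lambda>p. (fst p, snd (snd p))"]
      by (fastforce simp: S_def intro!: continuous_intros)
    moreover have "continuous_on S (\<lambda>p. w (fst (snd p)) (snd (snd p)))"
      using continuous_on_compose2[OF cont, of S "\<lambda>p. (fst (snd p), snd (snd p))"]
      by (fastforce simp: S_def intro!: continuous_intros)
    ultimately show ?thesis
      unfolding \<Phi>_def case_prod_unfold using \<rho> by (intro continuous_intros) auto
  qed
  obtain p where p: "p \<in> S" "\<And>q. q \<in> S \<Longrightarrow> (\<lambda>(x, y, t). \<Phi> x y t) q \<le> (\<lambda>(x, y, t). \<Phi> x y t) p"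
    using continuous_attains_sup[OF compS _ contS] inS by blast
  obtain \<xi> \<upsilon> \<sigma> where p_eq: "p = (\<xi>, \<upsilon>, \<sigma>)" by (cases p) auto
  have max: "\<Phi> x y t \<le> \<Phi> \<xi> \<upsilon> \<sigma>" if "(x, y, t) \<in> S" for x y t
    using p(2)[OF that] p_eq by simp
  have S: "\<bar>\<xi> - x0\<bar> \<le> \<rho>" "\<bar>\<upsilon> - x0\<bar> \<le> \<rho>" "\<upsilon> \<le> \<xi>" "0 \<le> \<sigma>" "\<sigma> \<le> \<tau>"
    using p(1) by (auto simp: p_eq S_def)
  define r where "r = \<xi> - \<upsilon>"
  have r: "0 \<le> r" "r \<le> 2 * \<rho>" using S by (auto simp: r_def)
  have bump: "0 \<le> r - r\<^sup>2 / (8 * \<rho>)"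
  proof -
    have "r * r \<le> r * (8 * \<rho>)" using r \<rho> by (intro mult_left_mono) auto
    then show ?thesis using \<rho> by (simp add: field_simps power2_eq_square)
  qed
  have "\<Phi> \<xi> \<upsilon> \<sigma> \<le> 0"
  proof (rule ccontr)
    assume pos: "\<not> \<Phi> \<xi> \<upsilon> \<sigma> \<le> 0"
    have K0: "0 \<le> K * (r - r\<^sup>2 / (8 * \<rho>))" using K bump by simp
    then have gt: "w \<xi> \<sigma> - w \<upsilon> \<sigma> > N * ((\<xi> - x0)\<^sup>2 + (\<upsilon> - x0)\<^sup>2)"
      using pos by (simp add: \<Phi>_def r_def)
    have ge0: "N * ((\<xi> - x0)\<^sup>2 + (\<upsilon> - x0)\<^sup>2) \<ge> 0" using N by simp
    have ww: "w \<xi> \<sigma> - w \<upsilon> \<sigma> \<le> 2 * W" using w[of \<xi> \<sigma>] w[of \<upsilon> \<sigma>] S by auto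
    have NW: "N * \<rho>\<^sup>2 = 2 * W" using \<rho> by (simp add: N_def)
    have "\<sigma> \<noteq> 0" using gt ge0 w0 S by auto
    then have \<sigma>: "0 < \<sigma>" using S by simp
    have "\<upsilon> \<noteq> \<xi>" using gt ge0 by auto
    then have lt: "\<upsilon> < \<xi>" using S by simp
    \<comment> \<open>At distance \<open>\<rho>\<close> from \<open>x0\<close> the penalty would
      already equal \<open>2 * W\<close>, the largest possible value of the difference of
      \<open>w\<close>; hence both points are interior.\<close>
    have small: "\<bar>z - x0\<bar> < \<rho>" if "N * (z - x0)\<^sup>2 < 2 * W" "\<bar>z - x0\<bar> \<le> \<rho>" for z
      using that NW by (metis less_eq_real_def order_less_irrefl power2_abs)
    have "N * (\<xi> - x0)\<^sup>2 + N * (\<upsilon> - x0)\<^sup>2 < 2 * W" "N * (\<xi> - x0)\<^sup>2 \<ge> 0" "N * (\<upsilon> - x0)\<^sup>2 \<ge> 0"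
      using gt ww N by (simp_all add: algebra_simps)
    then have in1: "\<bar>\<xi> - x0\<bar> < \<rho>" and in2: "\<bar>\<upsilon> - x0\<bar> < \<rho>"
      using small S by (metis add.commute add_increasing2 le_less_trans le_add_same_cancel1)+
    \<comment> \<open>\<open>q\<close> is the slope of the concave modulus
      \<open>r - r\<^sup>2 / (8 * \<rho>)\<close> at distance \<open>r\<close>.\<close>
    define q where "q = 1 - r / (4 * \<rho>)"
    have q: "0 \<le> q" "q \<le> 1" using r \<rho> by (auto simp: q_def field_simps)
    \<comment> \<open>Within these radii the moving point stays in the open interval and does not
      cross the other one, so the comparison remains inside \<open>S\<close>.\<close>
    define e1 where "e1 = min (\<xi> - \<upsilon>) (\<rho> - \<bar>\<xi> - x0\<bar>)"
    define e2 where "e2 = min (\<xi> - \<upsilon>) (\<rho> - \<bar>\<upsilon> - x0\<bar>)"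
    have e: "e1 > 0" "e2 > 0" using lt in1 in2 by (auto simp: e1_def e2_def)
    have near1: "\<bar>z - x0\<bar> < \<rho> \<and> \<upsilon> < z" if "\<bar>z - \<xi>\<bar> < e1" for z
      using that by (auto simp: e1_def)
    have near2: "\<bar>z - x0\<bar> < \<rho> \<and> z < \<xi>" if "\<bar>z - \<upsilon>\<bar> < e2" for z
      using that by (auto simp: e2_def)
    have D1: "((\<lambda>z. \<Phi> z \<upsilon> \<sigma>) has_real_derivative
        wx z \<sigma> - K * (1 - (z - \<upsilon>) / (4 * \<rho>)) - N * (2 * (z - x0))) (at z)"
      if "\<bar>z - \<xi>\<bar> < e1" for z
      unfolding \<Phi>_def using near1[OF that] \<sigma> S \<rho>
      by (auto intro!: derivative_eq_intros w_x simp: field_simps)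
    have D2: "((\<lambda>z. wx z \<sigma> - K * (1 - (z - \<upsilon>) / (4 * \<rho>)) - N * (2 * (z - x0)))
        has_real_derivative wxx \<xi> \<sigma> + K / (4 * \<rho>) - 2 * N) (at \<xi>)"
      using in1 \<sigma> S \<rho> by (auto intro!: derivative_eq_intros w_xx simp: field_simps)
    have max1: "\<Phi> z \<upsilon> \<sigma> \<le> \<Phi> \<xi> \<upsilon> \<sigma>" if "\<bar>z - \<xi>\<bar> < e1" for z
      using near1[OF that] S by (intro max) (auto simp: S_def abs_le_iff)
    have E1: "((\<lambda>z. \<Phi> \<xi> z \<sigma>) has_real_derivative
        - wx z \<sigma> + K * (1 - (\<xi> - z) / (4 * \<rho>)) - N * (2 * (z - x0))) (at z)"
      if "\<bar>z - \<upsilon>\<bar> < e2" for z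
      unfolding \<Phi>_def using near2[OF that] \<sigma> S \<rho>
      by (auto intro!: derivative_eq_intros w_x simp: field_simps)
    have E2: "((\<lambda>z. - wx z \<sigma> + K * (1 - (\<xi> - z) / (4 * \<rho>)) - N * (2 * (z - x0)))
        has_real_derivative - wxx \<upsilon> \<sigma> + K / (4 * \<rho>) - 2 * N) (at \<upsilon>)"
      using in2 \<sigma> S \<rho> by (auto intro!: derivative_eq_intros w_xx simp: field_simps)
    have max2: "\<Phi> \<xi> z \<sigma> \<le> \<Phi> \<xi> \<upsilon> \<sigma>" if "\<bar>z - \<upsilon>\<bar> < e2" for z
      using near2[OF that] S by (intro max) (auto simp: S_def abs_le_iff)
    note d1 = derivs_at_local_max[OF e(1) D1 D2 max1, simplified]
    note d2 = derivs_at_local_max[OF e(2) E1 E2 max2, simplified]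
    \<comment> \<open>At both points \<open>wx\<close> has the common part \<open>K * q\<close>. In
      the difference of the two equations it therefore meets only
      \<open>a \<xi> \<sigma> - a \<upsilon> \<sigma>\<close>, which the Lipschitz bound on
      \<open>a\<close> controls.\<close>
    have wx1: "wx \<xi> \<sigma> = K * q + 2 * N * (\<xi> - x0)"
      using d1(1) by (simp add: q_def r_def algebra_simps)
    have wx2: "wx \<upsilon> \<sigma> = K * q - 2 * N * (\<upsilon> - x0)"
      using d2(1) by (simp add: q_def r_def algebra_simps)
    have F: "((\<lambda>s. \<Phi> \<xi> \<upsilon> s) has_real_derivative
        (wxx \<xi> \<sigma> - a \<xi> \<sigma> * wx \<xi> \<sigma> - c \<xi> \<sigma> * w \<xi> \<sigma>)
        - (wxx \<upsilon> \<sigma> - a \<upsilon> \<sigma> * wx \<upsilon> \<sigma> - c \<upsilon> \<sigma> * w \<upsilon> \<sigma>)) (at \<sigma>)"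
      unfolding \<Phi>_def using in1 in2 \<sigma> S
      by (auto intro!: derivative_eq_intros w_t)
    have d3: "0 \<le> (wxx \<xi> \<sigma> - a \<xi> \<sigma> * wx \<xi> \<sigma> - c \<xi> \<sigma> * w \<xi> \<sigma>)
        - (wxx \<upsilon> \<sigma> - a \<upsilon> \<sigma> * wx \<upsilon> \<sigma> - c \<upsilon> \<sigma> * w \<upsilon> \<sigma>)"
      by (rule deriv_nonneg_at_left_max[OF F \<sigma>]) (use S in \<open>auto intro!: max simp: S_def abs_le_iff\<close>)
    have A1: "- ((a \<xi> \<sigma> - a \<upsilon> \<sigma>) * (K * q)) \<le> K / (4 * \<rho>)"
    proof -
      have "\<bar>a \<xi> \<sigma> - a \<upsilon> \<sigma>\<bar> \<le> A * r"
        using a_lip[OF in1 in2 \<sigma>] S lt by (simp add: r_def)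
      also have "\<dots> \<le> A * (2 * \<rho>)" using r nonneg by (intro mult_left_mono) auto
      finally have "\<bar>a \<xi> \<sigma> - a \<upsilon> \<sigma>\<bar> \<le> 2 * A * \<rho>" by simp
      then have "\<bar>(a \<xi> \<sigma> - a \<upsilon> \<sigma>) * (K * q)\<bar> \<le> (2 * A * \<rho>) * (K * 1)"
        unfolding abs_mult using K q nonneg \<rho> by (intro mult_mono) auto
      also have "\<dots> \<le> K / (4 * \<rho>)"
      proof -
        have "K * (8 * A * \<rho>\<^sup>2) \<le> K * 1" using K \<rho> by (intro mult_left_mono) auto
        then show ?thesis using \<rho> by (simp add: field_simps power2_eq_square)
      qed
      finally show ?thesis by linarith
    qed
    have A2: "- (a z \<sigma> * (2 * N * (z - x0))) \<le> 2 * N * B * \<rho>" if "\<bar>z - x0\<bar> < \<rho>" for z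
    proof -
      have "\<bar>a z \<sigma> * (2 * N * (z - x0))\<bar> \<le> B * (2 * N * \<rho>)"
        unfolding abs_mult using N nonneg that a[OF that \<sigma>] S by (intro mult_mono) auto
      then show ?thesis by (simp add: mult_ac) 
    qed
    have A3: "\<bar>c z \<sigma> * w z \<sigma>\<bar> \<le> C * W" if "\<bar>z - x0\<bar> < \<rho>" for z
      unfolding abs_mult using nonneg that c[OF that \<sigma>] w[of z \<sigma>] S by (intro mult_mono) auto
    have "a \<xi> \<sigma> * wx \<xi> \<sigma> - a \<upsilon> \<sigma> * wx \<upsilon> \<sigma> = (a \<xi> \<sigma> - a \<upsilon> \<sigma>) * (K * q)
        + a \<xi> \<sigma> * (2 * N * (\<xi> - x0)) + a \<upsilon> \<sigma> * (2 * N * (\<upsilon> - x0))"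
      by (simp add: wx1 wx2 algebra_simps)
    \<comment> \<open>The second-order conditions give \<open>wxx \<xi> \<sigma> - wxx \<upsilon>
      \<sigma> \<le> 4 * N - K / (2 * \<rho>)\<close>; after \<open>A1\<close> half of the concavity
      is left, and the choice of \<open>K\<close> makes it too large.\<close>
    then have "K / (4 * \<rho>) \<le> 4 * N + 4 * N * B * \<rho> + 2 * C * W"
      using d3 d1(2) d2(2) A1 A2[OF in1] A2[OF in2] A3[OF in1] A3[OF in2] by linarith
    moreover have "K / (4 * \<rho>) = 4 * N + 4 * N * B * \<rho> + 2 * C * W + 1"
      using \<rho> by (simp add: K_def)
    ultimately show False by simp
  qed
  then have "\<Phi> x y t \<le> 0" using max[OF inS] by simp
  moreover have "0 \<le> K * ((x - y)\<^sup>2 / (8 * \<rho>))" using K \<rho> by simp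
  ultimately show ?thesis by (simp add: \<Phi>_def algebra_simps)
qed

section \<open>Parameter integrals and the truncated Laplace transform\<close>

text \<open>The Lipschitz bound towards \<open>x\<close> dominates the difference quotients, so
  dominated convergence along sequences needs the derivative in the parameter at the single point
  \<open>x\<close> only.\<close>

lemma integral_deriv_dominated:
  fixes f :: "real \<Rightarrow> real \<Rightarrow> real"
  assumes "d > 0"
    and int: "\<And>y. \<bar>y - x\<bar> < d \<Longrightarrow> f y integrable_on {p..q}"
    and lip: "\<And>y s. \<bar>y - x\<bar> < d \<Longrightarrow> s \<in> {p..q} \<Longrightarrow> \<bar>f y s - f x s\<bar> \<le> C * \<bar>y - x\<bar>"
    and deriv: "\<And>s. s \<in> {p..q} \<Longrightarrow> ((\<lambda>y. f y s) has_real_derivative g s) (at x)"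
  shows "((\<lambda>y. integral {p..q} (f y)) has_real_derivative integral {p..q} g) (at x)"
proof -
  define D where "D y s = (f y s - f x s) / (y - x)" for y s
  have seq: "(\<lambda>k. integral {p..q} (D (X k))) \<longlonglongrightarrow> integral {p..q} g"
    if X: "\<And>k. X k \<noteq> x" "\<And>k. \<bar>X k - x\<bar> < d" "X \<longlonglongrightarrow> x" for X
  proof -
    have 1: "D (X k) integrable_on {p..q}" for k
      unfolding D_def divide_inverse using int[of "X k"] int[of x] X(2)[of k] \<open>d > 0\<close>
      by (intro integrable_on_mult_left integrable_diff) auto
    have 2: "norm (D (X k) s) \<le> C" if "s \<in> {p..q}" for k s
      using lip[OF X(2)[of k] that] X(1)[of k] by (simp add: D_def abs_divide divide_le_eq)
    have 3: "(\<lambda>k. D (X k) s) \<longlonglongrightarrow> g s" if "s \<in> {p..q}" for s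
      using deriv[OF that] X unfolding has_field_derivative_iff tendsto_at_iff_sequentially D_def
      by (auto simp: o_def)
    have 4: "(\<lambda>s. C) integrable_on {p..q}" by (rule integrable_const_ivl)
    show ?thesis
      using dominated_convergence[OF 1 4 2 3] by blast
  qed
  show "((\<lambda>y. integral {p..q} (f y)) has_real_derivative integral {p..q} g) (at x)"
    unfolding has_field_derivative_iff tendsto_at_iff_sequentially
  proof (intro allI impI)
    fix X :: "nat \<Rightarrow> real" assume X: "\<forall>i. X i \<in> UNIV - {x}" "X \<longlonglongrightarrow> x"
    have "eventually (\<lambda>k. \<bar>X k - x\<bar> < d) sequentially"
      using tendstoD[OF X(2) \<open>d > 0\<close>] by (simp add: dist_real_def)
    \<comment> \<open>Only the tail from \<open>K\<close> on lies in the neighbourhood where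
      \<open>f\<close> is integrable; shifting the index keeps the limit.\<close>
    then obtain K where K: "\<And>k. k \<ge> K \<Longrightarrow> \<bar>X k - x\<bar> < d" by (auto simp: eventually_sequentially)
    have "(\<lambda>k. integral {p..q} (D (X (k + K)))) \<longlonglongrightarrow> integral {p..q} g"
      using seq[of "\<lambda>k. X (k + K)"] X K LIMSEQ_ignore_initial_segment[OF X(2)] by auto
    moreover have "integral {p..q} (D (X (k + K)))
        = ((\<lambda>y. (integral {p..q} (f y) - integral {p..q} (f x)) / (y - x)) \<circ> X) (k + K)" for k
      unfolding D_def o_def divide_inverse
      using int[of x] int[OF K[of "k + K"]] \<open>d > 0\<close> by (simp add: Henstock_Kurzweil_Integration.integral_diff)
    ultimately show "((\<lambda>y. (integral {p..q} (f y) - integral {p..q} (f x)) / (y - x)) \<circ> X)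
        \<longlonglongrightarrow> integral {p..q} g"
      by (simp add: LIMSEQ_offset)
  qed
qed

text \<open>Boundary values at \<open>x = 0\<close> are attained for almost every \<open>t\<close>
  only, hence the exceptional set \<open>N\<close>.\<close>

lemma integral_tendsto_dominated_AE:
  fixes f :: "real \<Rightarrow> real \<Rightarrow> real"
  assumes "d > 0"
    and int: "\<And>x. 0 < x \<Longrightarrow> x < d \<Longrightarrow> f x integrable_on {p..q}"
    and bound: "\<And>x t. 0 < x \<Longrightarrow> x < d \<Longrightarrow> t \<in> {p..q} \<Longrightarrow> \<bar>f x t\<bar> \<le> C"
    and N: "negligible N"
    and lim: "\<And>t. t \<in> {p..q} - N \<Longrightarrow> ((\<lambda>x. f x t) \<longlongrightarrow> 0) (at_right 0)"
  shows "((\<lambda>x. integral {p..q} (f x)) \<longlongrightarrow> 0) (at_right 0)"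
  unfolding tendsto_at_iff_sequentially
proof (intro allI impI)
  fix X :: "nat \<Rightarrow> real" assume X: "\<forall>i. X i \<in> {0<..} - {0}" "X \<longlonglongrightarrow> 0"
  obtain K where K: "\<And>k. k \<ge> K \<Longrightarrow> \<bar>X k\<bar> < d"
    using tendstoD[OF X(2) \<open>d > 0\<close>] by (auto simp: eventually_sequentially)
  \<comment> \<open>Setting the integrand to 0 on \<open>N\<close> gives convergence at every
    \<open>t\<close> and leaves the integrals unchanged.\<close>
  define h where "h k t = (if t \<in> N then 0 else f (X (k + K)) t)" for k t
  have eq: "integral {p..q} (h k) = integral {p..q} (f (X (k + K)))" for k
    by (rule integral_spike[OF N]) (auto simp: h_def)
  have pos: "0 < X (k + K)" "X (k + K) < d" for k
    using X(1) K[of "k + K"] by (auto simp: greaterThan_def)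
  have 1: "h k integrable_on {p..q}" for k
    by (rule integrable_spike[OF int[OF pos[of k]] N]) (auto simp: h_def)
  have 2: "norm (h k t) \<le> \<bar>C\<bar>" if "t \<in> {p..q}" for k t
    using bound[OF pos[of k] that] by (auto simp: h_def)
  have 3: "(\<lambda>k. h k t) \<longlonglongrightarrow> 0" if "t \<in> {p..q}" for t
  proof (cases "t \<in> N")
    case False
    then have "(\<lambda>k. f (X k) t) \<longlonglongrightarrow> 0"
      using lim[of t] that X unfolding tendsto_at_iff_sequentially by (auto simp: o_def)
    from LIMSEQ_ignore_initial_segment[OF this, of K] show ?thesis using False by (simp add: h_def)
  qed (simp add: h_def)
  have "(\<lambda>k. integral {p..q} (h k)) \<longlonglongrightarrow> integral {p..q} (\<lambda>t. 0)"
    by (rule dominated_convergence(2)[OF 1 integrable_const_ivl 2 3])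
  then have "(\<lambda>k. integral {p..q} (f (X (k + K)))) \<longlonglongrightarrow> 0" by (simp add: eq)
  then show "((\<lambda>x. integral {p..q} (f x)) \<circ> X) \<longlonglongrightarrow> 0"
    unfolding o_def by (rule LIMSEQ_offset)
qed

text \<open>Test \<open>f\<close> against the kernel \<open>exp (- exp (n * (c - t))) - 1\<close>.
  Its exponential series consists of Laplace weights at \<open>n\<close>, \<open>2 * n\<close>, and
  so on, whose integrals against \<open>f\<close> are small by assumption; the kernel itself tends
  to -1 for \<open>t < c\<close> and to 0 for \<open>t > c\<close>. So the integral of
  \<open>f\<close> over \<open>{0..c}\<close> is 0 for every \<open>c\<close>.\<close>

lemma mikusinski:
  fixes f :: "real \<Rightarrow> real"
  assumes f: "continuous_on {0..\<tau>} f"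
    and laplace: "\<And>d. d < \<tau> \<Longrightarrow>
      \<exists>C. \<forall>n\<ge>(1::nat). \<bar>integral {0..\<tau>} (\<lambda>t. exp (- real n * t) * f t)\<bar> \<le> C * exp (- real n * d)"
    and t: "0 < t" "t < \<tau>"
  shows "f t = 0"
proof -
  obtain B where B: "\<And>t. t \<in> {0..\<tau>} \<Longrightarrow> \<bar>f t\<bar> \<le> B"
  proof -
    have "bounded (f ` {0..\<tau>})" using compact_continuous_image[OF f] compact_imp_bounded by auto
    then obtain B where "\<And>t. t \<in> {0..\<tau>} \<Longrightarrow> norm (f t) \<le> B" unfolding bounded_iff by blast
    then show ?thesis using that[of B] by simp
  qed
  have zero: "integral {0..c} f = 0" if c: "0 < c" "c < \<tau>" for c
  proof -
    \<comment> \<open>Any rate strictly between \<open>c\<close> and \<open>\<tau>\<close> will do: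
      the decay \<open>exp (- n * d)\<close> must beat the growth \<open>exp (n * c)\<close> of the
      kernel terms.\<close>
    define d where "d = (c + \<tau>) / 2"
    have d: "c < d" "d < \<tau>" using c by (auto simp: d_def)
    obtain C where C: "\<And>n::nat. n \<ge> 1 \<Longrightarrow>
        \<bar>integral {0..\<tau>} (\<lambda>t. exp (- real n * t) * f t)\<bar> \<le> C * exp (- real n * d)"
      using laplace[OF d(2)] by blast
    have C0: "C \<ge> 0"
    proof -
      have "0 \<le> C * exp (- real 1 * d)" using C[of 1] by linarith
      then show ?thesis by (simp add: zero_le_mult_iff)
    qed
    \<comment> \<open>The series starts at index 1: the constant term would bring in the plain
      integral of \<open>f\<close>, which the Laplace bound for \<open>n \<ge> 1\<close> does not
      cover.\<close>
    define g where "g n k t = (- exp (real n * (c - t))) ^ Suc k /\<^sub>R fact (Suc k)" for n k :: nat and t :: real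
    have gsum: "(\<lambda>k. g n k t) sums (exp (- exp (real n * (c - t))) - 1)" for n t
      using exp_converges[of "- exp (real n * (c - t))"]
      unfolding g_def by (subst sums_Suc_iff) simp
    have gint: "(\<lambda>t. g n k t * f t) integrable_on {0..\<tau>}" for n k
      unfolding g_def using f by (intro integrable_continuous_real continuous_intros) auto
    have gbound: "\<bar>integral {0..\<tau>} (\<lambda>t. g n k t * f t)\<bar>
        \<le> C * (exp (- real n * (d - c)) ^ Suc k /\<^sub>R fact (Suc k))" if "n \<ge> 1" for n k
    proof -
      \<comment> \<open>Term \<open>k\<close> is a multiple of the Laplace weight at the integer
        \<open>Suc k * n\<close>, which is at least 1.\<close>
      have eq: "g n k t * f t = ((- 1) ^ Suc k * exp (real (Suc k * n) * c) /\<^sub>R fact (Suc k)) *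
          (exp (- real (Suc k * n) * t) * f t)" for t
      proof -
        have "exp (real n * (c - t)) ^ Suc k = exp (real (Suc k * n) * c) * exp (- real (Suc k * n) * t)"
          unfolding exp_add[symmetric] exp_of_nat_mult[symmetric] by (simp add: algebra_simps)
        then show ?thesis
          unfolding g_def power_minus[of "exp _"] by simp
      qed
      have "\<bar>integral {0..\<tau>} (\<lambda>t. g n k t * f t)\<bar> = exp (real (Suc k * n) * c) / fact (Suc k)
          * \<bar>integral {0..\<tau>} (\<lambda>t. exp (- real (Suc k * n) * t) * f t)\<bar>"
        unfolding eq integral_mult_right abs_mult by (simp add: power_abs divide_inverse abs_mult)
      also have "\<dots> \<le> exp (real (Suc k * n) * c) / fact (Suc k) * (C * exp (- real (Suc k * n) * d))"
        using that by (intro mult_left_mono C) auto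
      also have "exp (real (Suc k * n) * c) * exp (- real (Suc k * n) * d) = exp (- real n * (d - c)) ^ Suc k"
        unfolding exp_add[symmetric] exp_of_nat_mult[symmetric] by (simp add: algebra_simps)
      then have "exp (real (Suc k * n) * c) / fact (Suc k) * (C * exp (- real (Suc k * n) * d))
          = C * (exp (- real n * (d - c)) ^ Suc k /\<^sub>R fact (Suc k))"
        by (simp add: divide_inverse mult_ac)
      finally show ?thesis .
    qed
    define H where "H n t = (exp (- exp (real n * (c - t))) - 1) * f t" for n :: nat and t
    have Hint: "H n integrable_on {0..\<tau>}" for n
      unfolding H_def using f by (intro integrable_continuous_real continuous_intros) auto
    have Hbound: "\<bar>integral {0..\<tau>} (H n)\<bar> \<le> C * (exp (exp (- real n * (d - c))) - 1)" if "n \<ge> 1" for n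
    proof -
      define E where "E k = exp (- real n * (d - c)) ^ Suc k /\<^sub>R fact (Suc k)" for k
      have E: "E sums (exp (exp (- real n * (d - c))) - 1)" "\<And>k. E k \<ge> 0"
        using exp_converges[of "exp (- real n * (d - c))"]
        unfolding E_def by (subst sums_Suc_iff) simp_all
      \<comment> \<open>This majorant grows with \<open>n\<close>, but it only serves to interchange
        sum and integral for fixed \<open>n\<close>.\<close>
      define M where "M = exp (exp (real n * c))"
      have bound: "norm ((\<Sum>k<m. g n k t) * f t) \<le> M * B" if "t \<in> {0..\<tau>}" for m t
      proof -
        define e where "e k = exp (real n * (c - t)) ^ Suc k /\<^sub>R fact (Suc k)" for k
        have e: "e sums (exp (exp (real n * (c - t))) - 1)"
          using exp_converges[of "exp (real n * (c - t))"]
          unfolding e_def by (subst sums_Suc_iff) simp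
        have "\<bar>\<Sum>k<m. g n k t\<bar> \<le> (\<Sum>k<m. e k)"
          by (rule order_trans[OF sum_abs sum_mono]) (simp add: g_def e_def power_abs abs_mult)
        also have "\<dots> \<le> exp (exp (real n * (c - t))) - 1"
          using sum_le_suminf[of e "{..<m}"] sums_summable[OF e] sums_unique[OF e]
          by (auto simp: e_def)
        also have "\<dots> \<le> M"
        proof -
          have "real n * (c - t) \<le> real n * c" using that by (intro mult_left_mono) auto
          then have "exp (exp (real n * (c - t))) \<le> M" by (simp add: M_def)
          then show ?thesis by simp
        qed
        finally have "\<bar>\<Sum>k<m. g n k t\<bar> \<le> M" .
        then show ?thesis using B[OF that] by (simp add: abs_mult mult_mono M_def)
      qed
      have lim: "(\<lambda>m. (\<Sum>k<m. g n k t) * f t) \<longlonglongrightarrow> H n t" for t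
        unfolding H_def using gsum[of n t] by (intro tendsto_intros) (simp add: sums_def)
      have int: "(\<lambda>t. (\<Sum>k<m. g n k t) * f t) integrable_on {0..\<tau>}" for m
        unfolding sum_distrib_right by (intro integrable_sum gint) auto
      have "(\<lambda>m. integral {0..\<tau>} (\<lambda>t. (\<Sum>k<m. g n k t) * f t)) \<longlonglongrightarrow> integral {0..\<tau>} (H n)"
        by (rule dominated_convergence(2)[OF int integrable_const_ivl bound lim])
      then have "(\<lambda>m. \<bar>integral {0..\<tau>} (\<lambda>t. (\<Sum>k<m. g n k t) * f t)\<bar>) \<longlonglongrightarrow> \<bar>integral {0..\<tau>} (H n)\<bar>"
        by (rule tendsto_rabs)
      moreover have "\<bar>integral {0..\<tau>} (\<lambda>t. (\<Sum>k<m. g n k t) * f t)\<bar> \<le> C * (exp (exp (- real n * (d - c))) - 1)" for m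
      proof -
        have "integral {0..\<tau>} (\<lambda>t. (\<Sum>k<m. g n k t) * f t) = (\<Sum>k<m. integral {0..\<tau>} (\<lambda>t. g n k t * f t))"
          unfolding sum_distrib_right by (intro integral_sum gint) auto
        then have "\<bar>integral {0..\<tau>} (\<lambda>t. (\<Sum>k<m. g n k t) * f t)\<bar>
            \<le> (\<Sum>k<m. \<bar>integral {0..\<tau>} (\<lambda>t. g n k t * f t)\<bar>)" by simp
        also have "\<dots> \<le> (\<Sum>k<m. C * E k)" unfolding E_def using gbound[OF that] by (intro sum_mono)
        also have "\<dots> = C * (\<Sum>k<m. E k)" by (simp add: sum_distrib_left)
        also have "\<dots> \<le> C * suminf E"
          using C0 E sums_summable by (intro mult_left_mono sum_le_suminf) auto
        also have "suminf E = exp (exp (- real n * (d - c))) - 1" using sums_unique[OF E(1)] by simp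
        finally show ?thesis .
      qed
      ultimately show ?thesis by (intro LIMSEQ_le_const2) auto
    qed
    have ninf: "filterlim (\<lambda>n. real n * r) at_top sequentially" if "r > 0" for r
      using filterlim_tendsto_pos_mult_at_top[OF tendsto_const that filterlim_real_sequentially]
      by (simp add: mult.commute)
    have expinf: "(\<lambda>n. exp (- (real n * r))) \<longlonglongrightarrow> 0" if "r > 0" for r
      using filterlim_compose[OF exp_at_bot filterlim_uminus_at_bot_at_top]
      by (rule filterlim_compose) (rule ninf[OF that])
    have "(\<lambda>n. integral {0..\<tau>} (H n)) \<longlonglongrightarrow> 0"
    proof (rule Lim_null_comparison)
      show "eventually (\<lambda>n. norm (integral {0..\<tau>} (H n)) \<le> C * (exp (exp (- (real n * (d - c)))) - 1)) sequentially"
        using Hbound by (intro eventually_sequentiallyI[of 1]) simp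
      have "(\<lambda>n. C * (exp (exp (- (real n * (d - c)))) - 1)) \<longlonglongrightarrow> C * (exp 0 - 1)"
        using d by (intro tendsto_intros expinf) auto
      then show "(\<lambda>n. C * (exp (exp (- (real n * (d - c)))) - 1)) \<longlonglongrightarrow> 0" by simp
    qed
    \<comment> \<open>At \<open>t = c\<close> the kernel is constantly \<open>exp (- 1) - 1\<close>;
      this single point is removed by \<open>integral_spike\<close> afterwards.\<close>
    moreover have "(\<lambda>n. integral {0..\<tau>} (H n)) \<longlonglongrightarrow>
        integral {0..\<tau>} (\<lambda>t. if t < c then - f t else if t = c then (exp (- 1) - 1) * f t else 0)"
    proof (rule dominated_convergence(2)[OF Hint integrable_const_ivl])
      fix n t assume "t \<in> {0..\<tau>}"
      moreover have "\<bar>exp (- exp (real n * (c - t))) - 1\<bar> \<le> 1" by simp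
      ultimately have "\<bar>exp (- exp (real n * (c - t))) - 1\<bar> * \<bar>f t\<bar> \<le> 1 * B"
        using B by (intro mult_mono) auto
      then show "norm (H n t) \<le> B" by (simp add: H_def abs_mult)
    next
      fix t assume "t \<in> {0..\<tau>}"
      consider "t < c" | "t = c" | "t > c" by linarith
      then show "(\<lambda>n. H n t) \<longlonglongrightarrow> (if t < c then - f t else if t = c then (exp (- 1) - 1) * f t else 0)"
      proof cases
        case 1
        have "(\<lambda>n. exp (- exp (real n * (c - t)))) \<longlonglongrightarrow> 0"
          using 1 by (intro filterlim_compose[OF exp_at_bot]
            filterlim_compose[OF filterlim_uminus_at_bot_at_top] filterlim_compose[OF exp_at_top] ninf) auto
        then have "(\<lambda>n. H n t) \<longlonglongrightarrow> (0 - 1) * f t" unfolding H_def by (intro tendsto_intros)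
        then show ?thesis using 1 by simp
      next
        case 3
        have "(\<lambda>n. exp (real n * (c - t))) \<longlonglongrightarrow> 0"
          using expinf[of "t - c"] 3 by (simp add: algebra_simps)
        then have "(\<lambda>n. H n t) \<longlonglongrightarrow> (exp (- 0) - 1) * f t" unfolding H_def by (intro tendsto_intros)
        then show ?thesis using 3 by simp
      qed (simp add: H_def)
    qed
    ultimately have "integral {0..\<tau>} (\<lambda>t. if t < c then - f t else if t = c then (exp (- 1) - 1) * f t else 0) = 0"
      using LIMSEQ_unique by blast
    also have "integral {0..\<tau>} (\<lambda>t. if t < c then - f t else if t = c then (exp (- 1) - 1) * f t else 0)
        = integral {0..\<tau>} (\<lambda>t. if t \<in> {0..c} then - f t else 0)"
      by (rule integral_spike[of "{c}"]) auto
    also have "\<dots> = integral {0..c} (\<lambda>t. - f t)"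
      unfolding integral_restrict_Int using c by simp
    finally show ?thesis by simp
  qed
  \<comment> \<open>The integral from 0 vanishes for all upper limits near \<open>t\<close>, and so
    does its derivative \<open>f t\<close>.\<close>
  have "((\<lambda>x. integral {0..x} f) has_real_derivative f t) (at t within {0..\<tau>})"
    using t by (intro integral_has_real_derivative f) auto
  then have "((\<lambda>x. integral {0..x} f) has_real_derivative f t) (at t)"
    using t by (simp add: at_within_Icc_at)
  moreover have "((\<lambda>x. integral {0..x} f) has_real_derivative 0) (at t)"
  proof (rule has_field_derivative_transform_within_open[of "\<lambda>x. 0" _ _ "{0<..<\<tau>}"])
  qed (use t zero in auto)
  ultimately show ?thesis by (rule DERIV_unique)
qed

section \<open>A second-order linear equation with zero Cauchy data\<close>

lemma abs_le_mult_of_deriv: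
  fixes h h' :: "real \<Rightarrow> real"
  assumes deriv: "\<And>x. 0 < x \<Longrightarrow> x < b \<Longrightarrow> (h has_real_derivative h' x) (at x)"
    and bound: "\<And>x. 0 < x \<Longrightarrow> x < b \<Longrightarrow> \<bar>h' x\<bar> \<le> C"
    and lim: "(h \<longlongrightarrow> 0) (at_right 0)"
    and x: "0 < x" "x < b"
  shows "\<bar>h x\<bar> \<le> C * x"
proof -
  have "C \<ge> 0" using bound[OF x] by linarith
  \<comment> \<open>\<open>h\<close> has only a limit at 0, so the mean value estimate is made from
    \<open>y > 0\<close> and \<open>y\<close> is then sent to 0.\<close>
  have "\<bar>h x - h y\<bar> \<le> C * x" if "0 < y" "y < x" for y
  proof -
    have "norm (h x - h y) \<le> C * norm (x - y)"
      by (rule field_differentiable_bound[of "{0<..<b}" h h'])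
        (use that x deriv bound in \<open>auto intro: has_field_derivative_at_within\<close>)
    also have "\<dots> \<le> C * x" using that \<open>C \<ge> 0\<close> by (intro mult_left_mono) auto
    finally show ?thesis by simp
  qed
  then have "eventually (\<lambda>y. \<bar>h x - h y\<bar> \<le> C * x) (at_right 0)"
    using x by (auto simp: eventually_at_right_field)
  moreover have "((\<lambda>y. \<bar>h x - h y\<bar>) \<longlongrightarrow> \<bar>h x - 0\<bar>) (at_right 0)"
    by (intro tendsto_intros lim)
  ultimately have "\<bar>h x - 0\<bar> \<le> C * x"
    by (intro tendsto_upperbound[where F = "at_right 0"]) auto
  then show ?thesis by simp
qed

text \<open>The operator factors: for \<open>\<nu>\<^sup>2 = \<mu>\<^sup>2\<close> the derivative of
  \<open>exp (- \<nu> * x) * (g1 x + \<nu> * g x)\<close> is \<open>exp (- \<nu> * x) * R x\<close>.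
  Integrating from 0 for both signs of \<open>\<nu>\<close> and subtracting isolates
  \<open>g\<close>.\<close>

lemma ode_zero_cauchy_data_bound:
  fixes g g1 R :: "real \<Rightarrow> real"
  assumes "\<mu> \<ge> 1" and "b > 0"
    and g: "\<And>x. 0 < x \<Longrightarrow> x < b \<Longrightarrow> (g has_real_derivative g1 x) (at x)"
    and g1: "\<And>x. 0 < x \<Longrightarrow> x < b \<Longrightarrow> (g1 has_real_derivative \<mu>\<^sup>2 * g x + R x) (at x)"
    and R: "\<And>x. 0 < x \<Longrightarrow> x < b \<Longrightarrow> \<bar>R x\<bar> \<le> D"
    and lim: "(g \<longlongrightarrow> 0) (at_right 0)" "(g1 \<longlongrightarrow> 0) (at_right 0)"
    and x: "0 < x" "x < b"
  shows "\<bar>g x\<bar> \<le> D * b * exp (\<mu> * b)"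
proof -
  have D: "D \<ge> 0" using R[OF x] by linarith
  \<comment> \<open>Used for \<open>\<nu> = - \<mu>\<close>: the weight grows, which costs the
    exponential factor at once.\<close>
  have est: "\<bar>exp (- \<nu> * x) * (g1 x + \<nu> * g x)\<bar> \<le> exp (\<bar>\<nu>\<bar> * b) * D * b" if "\<nu>\<^sup>2 = \<mu>\<^sup>2" and "\<nu> < 0" for \<nu>
  proof -
    have "\<bar>exp (- \<nu> * x) * (g1 x + \<nu> * g x)\<bar> \<le> exp (\<bar>\<nu>\<bar> * b) * D * x"
    proof (rule abs_le_mult_of_deriv[OF _ _ _ x])
      fix y assume y: "0 < y" "y < b"
      show "((\<lambda>x. exp (- \<nu> * x) * (g1 x + \<nu> * g x)) has_real_derivative exp (- \<nu> * y) * R y) (at y)"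
        using that(1) by (auto intro!: derivative_eq_intros g g1 y simp: algebra_simps power2_eq_square)
      have "exp (- \<nu> * y) \<le> exp (\<bar>\<nu>\<bar> * b)"
        using y that by (simp add: mult_left_mono abs_if)
      then show "\<bar>exp (- \<nu> * y) * R y\<bar> \<le> exp (\<bar>\<nu>\<bar> * b) * D"
        unfolding abs_mult using R[OF y] by (intro mult_mono) auto
    next
      have "((\<lambda>x. exp (- \<nu> * x) * (g1 x + \<nu> * g x)) \<longlongrightarrow> exp (- \<nu> * 0) * (0 + \<nu> * 0)) (at_right 0)"
        by (intro tendsto_intros lim)
      then show "((\<lambda>x. exp (- \<nu> * x) * (g1 x + \<nu> * g x)) \<longlongrightarrow> 0) (at_right 0)" by simp
    qed
    also have "\<dots> \<le> exp (\<bar>\<nu>\<bar> * b) * D * b" using x D by (intro mult_left_mono) auto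
    finally show ?thesis .
  qed
  \<comment> \<open>For \<open>\<nu> = \<mu>\<close> the weight is at most 1; the exponential factor
    enters in \<open>A\<close>, where the weight is undone.\<close>
  have est': "\<bar>exp (- \<mu> * x) * (g1 x + \<mu> * g x)\<bar> \<le> D * b"
  proof -
    have "\<bar>exp (- \<mu> * x) * (g1 x + \<mu> * g x)\<bar> \<le> D * x"
    proof (rule abs_le_mult_of_deriv[OF _ _ _ x])
      fix y assume y: "0 < y" "y < b"
      show "((\<lambda>x. exp (- \<mu> * x) * (g1 x + \<mu> * g x)) has_real_derivative exp (- \<mu> * y) * R y) (at y)"
        by (auto intro!: derivative_eq_intros g g1 y simp: algebra_simps power2_eq_square)
      have "exp (- \<mu> * y) \<le> 1" using y \<open>\<mu> \<ge> 1\<close> by simp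
      then have "\<bar>exp (- \<mu> * y) * R y\<bar> \<le> 1 * D"
        unfolding abs_mult using R[OF y] by (intro mult_mono) auto
      then show "\<bar>exp (- \<mu> * y) * R y\<bar> \<le> D" by simp
    next
      have "((\<lambda>x. exp (- \<mu> * x) * (g1 x + \<mu> * g x)) \<longlongrightarrow> exp (- \<mu> * 0) * (0 + \<mu> * 0)) (at_right 0)"
        by (intro tendsto_intros lim)
      then show "((\<lambda>x. exp (- \<mu> * x) * (g1 x + \<mu> * g x)) \<longlongrightarrow> 0) (at_right 0)" by simp
    qed
    also have "\<dots> \<le> D * b" using x D by (intro mult_left_mono) auto
    finally show ?thesis .
  qed
  define X where "X = D * b * exp (\<mu> * b)"
  have A: "\<bar>g1 x + \<mu> * g x\<bar> \<le> X"
  proof -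
    have "\<bar>g1 x + \<mu> * g x\<bar> = exp (\<mu> * x) * \<bar>exp (- \<mu> * x) * (g1 x + \<mu> * g x)\<bar>"
      by (simp add: abs_mult exp_minus)
    also have "\<dots> \<le> exp (\<mu> * b) * (D * b)"
      using est' x \<open>\<mu> \<ge> 1\<close> by (intro mult_mono) auto
    finally show ?thesis by (simp add: X_def mult_ac)
  qed
  have B: "\<bar>g1 x - \<mu> * g x\<bar> \<le> X"
  proof -
    have "1 * \<bar>g1 x - \<mu> * g x\<bar> \<le> exp (\<mu> * x) * \<bar>g1 x - \<mu> * g x\<bar>"
      using x \<open>\<mu> \<ge> 1\<close> by (intro mult_right_mono) auto
    also have "\<dots> \<le> X"
      using est[of "- \<mu>"] \<open>\<mu> \<ge> 1\<close> by (simp add: X_def mult_ac abs_mult)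
    finally show ?thesis by simp
  qed
  have "2 * (\<mu> * \<bar>g x\<bar>) = \<bar>(g1 x + \<mu> * g x) - (g1 x - \<mu> * g x)\<bar>"
    using \<open>\<mu> \<ge> 1\<close> by (simp add: abs_mult)
  also have "\<dots> \<le> 2 * X" using A B by linarith
  finally have "\<mu> * \<bar>g x\<bar> \<le> X" by simp
  moreover have "1 * \<bar>g x\<bar> \<le> \<mu> * \<bar>g x\<bar>" using \<open>\<mu> \<ge> 1\<close> by (intro mult_right_mono) auto
  ultimately show ?thesis unfolding X_def by linarith
qed

section \<open>Solutions with bounded slope\<close>

lemma abs_deriv_le_of_lipschitz_at:
  fixes f :: "real \<Rightarrow> real"
  assumes f: "(f has_real_derivative D) (at x)" and "d > 0"
    and le: "\<And>y. \<bar>y - x\<bar> < d \<Longrightarrow> \<bar>f y - f x\<bar> \<le> K * \<bar>y - x\<bar>"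
  shows "\<bar>D\<bar> \<le> K"
proof (rule tendsto_upperbound)
  show "((\<lambda>y. \<bar>(f y - f x) / (y - x)\<bar>) \<longlongrightarrow> \<bar>D\<bar>) (at x)"
    using f unfolding has_field_derivative_iff by (rule tendsto_rabs)
  have "\<bar>(f y - f x) / (y - x)\<bar> \<le> K" if "y \<noteq> x" "\<bar>y - x\<bar> < d" for y
    using le[OF that(2)] that(1) by (simp add: abs_divide divide_le_eq)
  then show "eventually (\<lambda>y. \<bar>(f y - f x) / (y - x)\<bar> \<le> K) (at x)"
    using \<open>d > 0\<close> by (auto simp: eventually_at dist_real_def)
qed simp

lemma lipschitz_of_deriv_bound:
  fixes f f' :: "real \<Rightarrow> real"
  assumes "\<And>x. p < x \<Longrightarrow> x < q \<Longrightarrow> (f has_real_derivative f' x) (at x)"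
    and "\<And>x. p < x \<Longrightarrow> x < q \<Longrightarrow> \<bar>f' x\<bar> \<le> C"
    and "p < x" "x < q" "p < y" "y < q"
  shows "\<bar>f x - f y\<bar> \<le> C * \<bar>x - y\<bar>"
  using field_differentiable_bound[of "{p<..<q}" f f' C x y] assms
  by (auto intro: has_field_derivative_at_within)

lemma quotient_tendsto_deriv:
  fixes f :: "real \<Rightarrow> real"
  assumes "(f has_real_derivative D) (at x)"
  shows "((\<lambda>h. (f (x + h) - f x) / h) \<longlongrightarrow> D) (at_right 0)"
  using assms unfolding DERIV_def by (rule tendsto_mono[rotated]) (simp add: at_le)

lemma exp_weight_le:
  fixes s t X Y C :: real
  assumes "s \<ge> 0" "t \<ge> 0" "\<bar>X - Y\<bar> \<le> C"
  shows "\<bar>exp (- s * t) * X - exp (- s * t) * Y\<bar> \<le> C"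
proof -
  have "exp (- s * t) \<le> 1" using assms by simp
  then have "exp (- s * t) * \<bar>X - Y\<bar> \<le> 1 * C" using assms by (intro mult_mono) auto
  then show ?thesis by (simp add: right_diff_distrib[symmetric] abs_mult)
qed

text \<open>The conditions concern the open strip and the initial time, with no lateral boundary
  data, so that restrictions to shorter strips, reflections and the zero function are instances as
  well. \<open>ux\<close> and \<open>uxx\<close> are pointwise derivatives without any assumed
  continuity.\<close>

locale burgers_strip =
  fixes b T B M :: real and u ux uxx :: "real \<Rightarrow> real \<Rightarrow> real"
  assumes b_pos: "b > 0" and T_pos: "T > 0"
    and cont: "continuous_on ({0<..<b} \<times> {0..<T}) (\<lambda>(x, t). u x t)"
    and u_x: "0 < x \<Longrightarrow> x < b \<Longrightarrow> 0 \<le> t \<Longrightarrow> t < T \<Longrightarrow> ((\<lambda>y. u y t) has_real_derivative ux x t) (at x)"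
    and u_xx: "0 < x \<Longrightarrow> x < b \<Longrightarrow> 0 \<le> t \<Longrightarrow> t < T \<Longrightarrow> ((\<lambda>y. ux y t) has_real_derivative uxx x t) (at x)"
    and u_t: "0 < x \<Longrightarrow> x < b \<Longrightarrow> 0 < t \<Longrightarrow> t < T \<Longrightarrow>
      ((\<lambda>s. u x s) has_real_derivative uxx x t - u x t * ux x t) (at t)"
    and u_0: "0 < x \<Longrightarrow> x < b \<Longrightarrow> u x 0 = 0"
    and u_le: "0 < x \<Longrightarrow> x < b \<Longrightarrow> 0 \<le> t \<Longrightarrow> t < T \<Longrightarrow> \<bar>u x t\<bar> \<le> B"
    and ux_le: "0 < x \<Longrightarrow> x < b \<Longrightarrow> 0 \<le> t \<Longrightarrow> t < T \<Longrightarrow> \<bar>ux x t\<bar> \<le> M"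
begin

section \<open>Interior regularity: local bounds on \<open>uxx\<close> and continuity of
  \<open>ux\<close> in time\<close>

lemma B_nonneg: "B \<ge> 0" and M_nonneg: "M \<ge> 0"
  using u_le[of "b / 2" 0] ux_le[of "b / 2" 0] b_pos T_pos by auto

lemma u_lipschitz:
  assumes "0 < x" "x < b" "0 < y" "y < b" "0 \<le> t" "t < T"
  shows "\<bar>u x t - u y t\<bar> \<le> M * \<bar>x - y\<bar>"
  by (rule lipschitz_of_deriv_bound[of 0 b _ "\<lambda>x. ux x t"]) (use assms u_x ux_le in auto)

lemma cont_compose:
  assumes "continuous_on S f" "continuous_on S g"
    and "\<And>p. p \<in> S \<Longrightarrow> 0 < f p \<and> f p < b \<and> 0 \<le> g p \<and> g p < T"
  shows "continuous_on S (\<lambda>p. u (f p) (g p))"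
proof -
  have "continuous_on S (\<lambda>p. (\<lambda>(x, t). u x t) (f p, g p))"
    by (rule continuous_on_compose2[OF cont]) (use assms in \<open>auto intro!: continuous_intros\<close>)
  then show ?thesis by simp
qed

lemma cont_t: "0 < x \<Longrightarrow> x < b \<Longrightarrow> S \<subseteq> {0..<T} \<Longrightarrow> continuous_on S (u x)"
  using cont_compose[of S "\<lambda>_. x" "\<lambda>t. t"] by force

text \<open>The difference quotient \<open>w\<close> solves a linear equation with transport
  coefficient \<open>u (x + h) t\<close> and zeroth-order coefficient \<open>ux x t\<close>. These
  are bounded by \<open>B\<close> and \<open>M\<close>, the first is \<open>M\<close>-Lipschitz in
  \<open>x\<close>, and \<open>w\<close> is bounded by \<open>M\<close>; so the constants do not
  depend on \<open>h\<close>. The sign \<open>\<sigma>\<close> provides the estimate for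
  \<open>w\<close> and for its negative.\<close>

lemma difference_quotient_one_sided:
  fixes \<rho> h \<sigma> x0 :: real
  defines "w \<equiv> \<lambda>x t. \<sigma> * ((u (x + h) t - u x t) / h)"
  defines "N \<equiv> 2 * M / \<rho>\<^sup>2"
  defines "K \<equiv> 4 * \<rho> * (4 * N + 4 * N * B * \<rho> + 2 * M * M + 1)"
  assumes \<rho>: "\<rho> > 0" "8 * M * \<rho>\<^sup>2 \<le> 1" and h: "0 < h" and \<sigma>: "\<bar>\<sigma>\<bar> = 1"
    and x0: "0 < x0 - \<rho>" "x0 + \<rho> + h < b"
    and xy: "y \<le> x" "\<bar>x - x0\<bar> \<le> \<rho>" "\<bar>y - x0\<bar> \<le> \<rho>" and t: "0 \<le> t" "t < T"
  shows "w x t - w y t \<le> K * (x - y) + N * ((x - x0)\<^sup>2 + (y - x0)\<^sup>2)"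
  unfolding K_def N_def
proof (rule doubling_estimate[where wx = "\<lambda>x t. \<sigma> * ((ux (x + h) t - ux x t) / h)"
      and wxx = "\<lambda>x t. \<sigma> * ((uxx (x + h) t - uxx x t) / h)"
      and a = "\<lambda>x t. u (x + h) t" and c = ux and A = M and \<tau> = t])
  have dom: "0 < z" "z < b" "0 < z + h" "z + h < b" if "\<bar>z - x0\<bar> \<le> \<rho>" for z
    using that x0 h by auto
  have "continuous_on ({x0 - \<rho>..x0 + \<rho>} \<times> {0..t}) (\<lambda>p. u (fst p + h) (snd p))"
    by (rule cont_compose) (use t x0 h in \<open>auto intro!: continuous_intros\<close>)
  moreover have "continuous_on ({x0 - \<rho>..x0 + \<rho>} \<times> {0..t}) (\<lambda>p. u (fst p) (snd p))"
    by (rule cont_compose) (use t x0 h in \<open>auto intro!: continuous_intros\<close>)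
  ultimately show "continuous_on ({x0 - \<rho>..x0 + \<rho>} \<times> {0..t}) (\<lambda>(x, t). w x t)"
    unfolding w_def case_prod_unfold using h by (intro continuous_intros) auto
  fix z s :: real assume z: "\<bar>z - x0\<bar> < \<rho>" and s: "0 < s" "s \<le> t"
  note d = dom[OF less_imp_le[OF z]]
  have sT: "0 \<le> s" "s < T" using s t by auto
  have shift: "((\<lambda>y. f (y + h)) has_real_derivative D) (at z)"
    if "(f has_real_derivative D) (at (z + h))" for f D
    using that by (simp add: DERIV_shift)
  show "((\<lambda>y. w y s) has_real_derivative \<sigma> * ((ux (z + h) s - ux z s) / h)) (at z)"
    unfolding w_def using d sT h
    by (intro DERIV_cmult DERIV_cdivide DERIV_diff shift u_x)
  show "((\<lambda>y. \<sigma> * ((ux (y + h) s - ux y s) / h)) has_real_derivative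
      \<sigma> * ((uxx (z + h) s - uxx z s) / h)) (at z)"
    using d sT h by (intro DERIV_cmult DERIV_cdivide DERIV_diff shift[of "\<lambda>y. ux y s"] u_xx)
  have "((\<lambda>s. w z s) has_real_derivative
      \<sigma> * (((uxx (z + h) s - u (z + h) s * ux (z + h) s) - (uxx z s - u z s * ux z s)) / h)) (at s)"
    unfolding w_def using d sT s by (intro DERIV_cmult DERIV_cdivide DERIV_diff u_t)
  then show "((\<lambda>s. w z s) has_real_derivative \<sigma> * ((uxx (z + h) s - uxx z s) / h)
      - u (z + h) s * (\<sigma> * ((ux (z + h) s - ux z s) / h)) - ux z s * w z s) (at s)"
    by (rule DERIV_cong) (use h in \<open>simp add: w_def field_simps\<close>)
  show "\<bar>u (z + h) s\<bar> \<le> B" using u_le[of "z + h" s] d sT by simp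
  show "\<bar>ux z s\<bar> \<le> M" using ux_le[of z s] d sT by simp
next
  fix z z' s :: real assume z: "\<bar>z - x0\<bar> < \<rho>" "\<bar>z' - x0\<bar> < \<rho>" and s: "0 < s" "s \<le> t"
  show "\<bar>u (z + h) s - u (z' + h) s\<bar> \<le> M * \<bar>z - z'\<bar>"
    using u_lipschitz[of "z + h" "z' + h" s] x0 h z s t by auto
next
  fix z s :: real assume z: "\<bar>z - x0\<bar> \<le> \<rho>"
  have d: "0 < z" "z < b" "0 < z + h" "z + h < b" using z x0 h by auto
  then show "w z 0 = 0" by (simp add: w_def u_0)
  assume s: "0 \<le> s" "s \<le> t"
  show "\<bar>w z s\<bar> \<le> M"
    using u_lipschitz[of "z + h" z s] d s t h \<sigma> by (simp add: w_def abs_mult abs_divide divide_le_eq)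
qed (use \<rho> B_nonneg M_nonneg xy t in auto)

text \<open>Letting \<open>h\<close> tend to 0 in the estimate for difference quotients makes
  \<open>ux\<close> Lipschitz at each \<open>x0\<close> in \<open>[p, q]\<close> with one constant
  for all \<open>x0\<close> and \<open>t\<close>, and this constant bounds
  \<open>uxx\<close>.\<close>

lemma uxx_bounded:
  assumes pq: "0 < p" "q < b"
  obtains K where "K \<ge> 0" "\<And>x t. p \<le> x \<Longrightarrow> x \<le> q \<Longrightarrow> 0 \<le> t \<Longrightarrow> t < T \<Longrightarrow> \<bar>uxx x t\<bar> \<le> K"
proof -
  \<comment> \<open>The three bounds keep \<open>x0 - \<rho>\<close> positive, keep
    \<open>x0 + \<rho> + h\<close> below \<open>b\<close> for \<open>h < \<rho>\<close>, and give
    \<open>8 * M * \<rho>\<^sup>2 \<le> 1\<close>.\<close>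
  define \<rho> where "\<rho> = min (min (p / 2) ((b - q) / 3)) (1 / (8 * M + 8))"
  have "\<rho> \<le> (b - q) / 3"
    unfolding \<rho>_def by (meson min.cobounded1 min.cobounded2 order_trans)
  moreover have "\<rho> > 0" "\<rho> < p" "\<rho> \<le> 1 / (8 * M + 8)"
    using pq M_nonneg by (auto simp: \<rho>_def)
  ultimately have \<rho>: "\<rho> > 0" "\<rho> < p" "\<rho> \<le> (b - q) / 3" "\<rho> \<le> 1 / (8 * M + 8)"
    by auto
  have "8 * M * \<rho>\<^sup>2 \<le> 1"
  proof -
    have "(8 * M + 8) * \<rho> \<le> 1" using \<rho> M_nonneg by (simp add: field_simps)
    moreover have "0 \<le> 8 * M * \<rho>" using M_nonneg \<rho> by simp
    ultimately have "\<rho> \<le> 1" and "8 * M * \<rho> \<le> 1" using \<rho> by (auto simp: algebra_simps)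
    then have "(8 * M * \<rho>) * \<rho> \<le> 1 * 1" using \<rho> by (intro mult_mono) auto
    then show ?thesis by (simp add: power2_eq_square mult_ac)
  qed
  note \<rho>M = \<rho>(1) this
  define N where "N = 2 * M / \<rho>\<^sup>2"
  define K where "K = 4 * \<rho> * (4 * N + 4 * N * B * \<rho> + 2 * M * M + 1)"
  have N: "N \<ge> 0" using M_nonneg by (simp add: N_def)
  have K: "K \<ge> 0" using \<rho> N B_nonneg M_nonneg by (simp add: K_def)
  have ux: "\<bar>ux x t - ux x0 t\<bar> \<le> (K + N * \<rho>) * \<bar>x - x0\<bar>"
    if x0: "p \<le> x0" "x0 \<le> q" and x: "\<bar>x - x0\<bar> < \<rho>" and t: "0 \<le> t" "t < T" for x x0 t
  proof (rule tendsto_upperbound)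
    have "0 < x" "x < b" "0 < x0" "x0 < b" using x0 x \<rho> by auto
    then show "((\<lambda>h. \<bar>(u (x + h) t - u x t) / h - (u (x0 + h) t - u x0 t) / h\<bar>)
        \<longlongrightarrow> \<bar>ux x t - ux x0 t\<bar>) (at_right 0)"
      using t by (intro tendsto_intros quotient_tendsto_deriv u_x)
    have "\<bar>(u (x + h) t - u x t) / h - (u (x0 + h) t - u x0 t) / h\<bar> \<le> (K + N * \<rho>) * \<bar>x - x0\<bar>"
      if h: "0 < h" "h < \<rho>" for h
    proof -
      have in_strip: "0 < x0 - \<rho>" "x0 + \<rho> + h < b" using x0 \<rho> h by auto
      note est = difference_quotient_one_sided[OF \<rho>M h(1) _ in_strip _ _ _ t,
          folded N_def, folded K_def]
      \<comment> \<open>The quadratic penalty is at most linear, as the distance to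
        \<open>x0\<close> is below \<open>\<rho>\<close>.\<close>
      have sq: "N * (x - x0)\<^sup>2 \<le> N * \<rho> * \<bar>x - x0\<bar>"
      proof -
        have "\<bar>x - x0\<bar> * \<bar>x - x0\<bar> \<le> \<rho> * \<bar>x - x0\<bar>" using x by (intro mult_right_mono) auto
        then have "(x - x0)\<^sup>2 \<le> \<rho> * \<bar>x - x0\<bar>" by (simp add: power2_eq_square)
        then show ?thesis using N by (simp add: mult_left_mono mult.assoc)
      qed
      define D where "D = (u (x + h) t - u x t) / h - (u (x0 + h) t - u x0 t) / h"
      \<comment> \<open>One of the two points is \<open>x0\<close>, so a single penalty term
        survives. The cases arise because the estimate wants its points ordered; the two values of
        \<open>\<sigma>\<close> bound \<open>D\<close> and \<open>- D\<close>.\<close>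
      have "D \<le> K * \<bar>x - x0\<bar> + N * (x - x0)\<^sup>2 \<and> - D \<le> K * \<bar>x - x0\<bar> + N * (x - x0)\<^sup>2"
      proof (cases "x0 \<le> x")
        case True
        then show ?thesis
          using est[of 1 x0 x] est[of "-1" x0 x] x \<rho> by (simp add: D_def diff_divide_distrib)
      next
        case False
        then show ?thesis
          using est[of 1 x x0] est[of "-1" x x0] x \<rho> by (simp add: D_def diff_divide_distrib)
      qed
      then have "\<bar>D\<bar> \<le> K * \<bar>x - x0\<bar> + N * \<rho> * \<bar>x - x0\<bar>" using sq by linarith
      then show ?thesis by (simp add: D_def distrib_right)
    qed
    then show "eventually (\<lambda>h. \<bar>(u (x + h) t - u x t) / h - (u (x0 + h) t - u x0 t) / h\<bar>
        \<le> (K + N * \<rho>) * \<bar>x - x0\<bar>) (at_right 0)"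
      using \<rho> by (auto simp: eventually_at_right_field)
  qed simp
  show ?thesis
  proof (rule that[of "K + N * \<rho>"])
    show "K + N * \<rho> \<ge> 0" using K N \<rho> by simp
    fix x t assume x: "p \<le> x" "x \<le> q" and t: "0 \<le> t" "t < T"
    show "\<bar>uxx x t\<bar> \<le> K + N * \<rho>"
    proof (rule abs_deriv_le_of_lipschitz_at[OF u_xx \<rho>(1)])
      show "\<bar>ux y t - ux x t\<bar> \<le> (K + N * \<rho>) * \<bar>y - x\<bar>" if "\<bar>y - x\<bar> < \<rho>" for y
        using ux[OF x that t] .
    qed (use x pq t in auto)
  qed
qed

text \<open>By the bound on \<open>uxx\<close> the difference quotients, which are continuous in
  \<open>t\<close>, converge to \<open>ux x\<close> uniformly in \<open>t\<close> at rate
  \<open>K * h\<close>.\<close>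

lemma cont_ux_t:
  assumes x: "0 < x" "x < b" and S: "S \<subseteq> {0..<T}"
  shows "continuous_on S (ux x)"
proof -
  define q where "q = (x + b) / 2"
  have q: "x < q" "q < b" using x by (auto simp: q_def)
  obtain K where K: "K \<ge> 0" "\<And>y t. x \<le> y \<Longrightarrow> y \<le> q \<Longrightarrow> 0 \<le> t \<Longrightarrow> t < T \<Longrightarrow> \<bar>uxx y t\<bar> \<le> K"
    using uxx_bounded[OF x(1) q(2)] by blast
  have rate: "\<bar>(u (x + h) t - u x t) / h - ux x t\<bar> \<le> K * h"
    if h: "0 < h" "h < q - x" and t: "0 \<le> t" "t < T" for h t
  proof -
    obtain z where z: "x < z" "z < x + h" "u (x + h) t - u x t = (x + h - x) * ux z t"
      using MVT2[of x "x + h" "\<lambda>y. u y t" "\<lambda>y. ux y t"] h t u_x x q by force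
    obtain z' where z': "x < z'" "z' < z" "ux z t - ux x t = (z - x) * uxx z' t"
      using MVT2[of x z "\<lambda>y. ux y t" "\<lambda>y. uxx y t"] h t u_xx x q z by force
    have "\<bar>(u (x + h) t - u x t) / h - ux x t\<bar> = \<bar>ux z t - ux x t\<bar>" using z h by simp
    also have "\<dots> = (z - x) * \<bar>uxx z' t\<bar>" using z' by (simp add: abs_mult)
    also have "\<dots> \<le> h * K" using z z' h t K by (intro mult_mono) auto
    finally show ?thesis by (simp add: mult.commute)
  qed
  show ?thesis
  proof (rule uniform_limit_theorem[where F = "at_right 0" and f = "\<lambda>h t. (u (x + h) t - u x t) / h"])
    show "\<forall>\<^sub>F h in at_right 0. continuous_on S (\<lambda>t. (u (x + h) t - u x t) / h)"
      unfolding eventually_at_right_field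
      by (rule exI[of _ "q - x"]) (use x q S in \<open>auto intro!: continuous_intros cont_t\<close>)
    show "uniform_limit S (\<lambda>h t. (u (x + h) t - u x t) / h) (ux x) (at_right 0)"
      unfolding uniform_limit_iff
    proof (intro allI impI)
      fix e :: real assume e: "e > 0"
      define h0 where "h0 = min (q - x) (e / (K + 1))"
      have "h0 > 0" using e q K by (auto simp: h0_def)
      moreover have "K * h < e" if "0 < h" "h < h0" for h
      proof -
        have "(K + 1) * h < e" using that K by (simp add: h0_def field_simps)
        then show ?thesis using that by (simp add: algebra_simps)
      qed
      ultimately show "\<forall>\<^sub>F h in at_right 0. \<forall>t\<in>S. dist ((u (x + h) t - u x t) / h) (ux x t) < e"
        unfolding eventually_at_right_field dist_real_def
        using rate S by (intro exI[of _ h0]) (fastforce simp: h0_def)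
    qed
  qed simp
qed

text \<open>Burgers' equation reads \<open>u\<^sub>t = F\<^sub>x\<close>, so that \<open>P\<close> has the derivatives \<open>P\<^sub>x = u\<close> and \<open>P\<^sub>t = F\<close>.\<close>

definition "F x t = ux x t - (u x t)\<^sup>2 / 2"
definition "P x t = integral {0..t} (F x)"
definition "\<phi> x t = exp (- P x t / 2)"

lemma cont_F_t: "0 < x \<Longrightarrow> x < b \<Longrightarrow> t < T \<Longrightarrow> continuous_on {0..t} (F x)"
  unfolding F_def by (intro continuous_intros cont_ux_t cont_t) auto

lemma F_le:
  assumes "0 < x" "x < b" "0 \<le> t" "t < T"
  shows "\<bar>F x t\<bar> \<le> M + B\<^sup>2 / 2"
proof -
  have "(u x t)\<^sup>2 \<le> B\<^sup>2" using u_le[OF assms] by (metis abs_le_square_iff abs_of_nonneg B_nonneg)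
  then show ?thesis using ux_le[OF assms] zero_le_power2[of "u x t"] unfolding F_def by linarith
qed

lemma P_le:
  assumes "0 < x" "x < b" "0 \<le> t" "t < T"
  shows "\<bar>P x t\<bar> \<le> (M + B\<^sup>2 / 2) * T"
proof -
  have "norm (P x t) \<le> (M + B\<^sup>2 / 2) * (t - 0)"
    unfolding P_def using assms by (intro integral_bound cont_F_t) (auto intro: F_le)
  also have "\<dots> \<le> (M + B\<^sup>2 / 2) * T" using assms M_nonneg by (intro mult_left_mono) auto
  finally show ?thesis by simp
qed

lemma F_x:
  assumes "0 < x" "x < b" "0 \<le> t" "t < T"
  shows "((\<lambda>y. F y t) has_real_derivative uxx x t - u x t * ux x t) (at x)"
  unfolding F_def using assms by (auto intro!: derivative_eq_intros u_x u_xx simp: field_simps)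

text \<open>The local bound on \<open>uxx\<close> allows differentiation under the integral; by
  Burgers' equation the new integrand is the time derivative of \<open>u\<close>, and the
  fundamental theorem with \<open>u x 0 = 0\<close> returns \<open>u x t\<close>.\<close>

lemma P_x:
  assumes x: "0 < x" "x < b" and t: "0 \<le> t" "t < T"
  shows "((\<lambda>y. P y t) has_real_derivative u x t) (at x)"
proof -
  define p q where "p = x / 2" and "q = (x + b) / 2"
  have pq: "0 < p" "p < x" "x < q" "q < b" using x by (auto simp: p_def q_def)
  obtain K where K: "K \<ge> 0" "\<And>y t. p \<le> y \<Longrightarrow> y \<le> q \<Longrightarrow> 0 \<le> t \<Longrightarrow> t < T \<Longrightarrow> \<bar>uxx y t\<bar> \<le> K"
    using uxx_bounded[OF pq(1) pq(4)] by blast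
  have le: "\<bar>uxx y s - u y s * ux y s\<bar> \<le> K + B * M" if "p < y" "y < q" "0 \<le> s" "s < T" for y s
  proof -
    have "\<bar>u y s * ux y s\<bar> \<le> B * M"
      unfolding abs_mult using that pq B_nonneg by (intro mult_mono u_le ux_le) auto
    then show ?thesis using K(2)[of y s] that by linarith
  qed
  have D: "((\<lambda>y. P y t) has_real_derivative integral {0..t} (\<lambda>s. uxx x s - u x s * ux x s)) (at x)"
    unfolding P_def
  proof (rule integral_deriv_dominated[where d = "min (x - p) (q - x)" and C = "K + B * M"])
    fix y s assume y: "\<bar>y - x\<bar> < min (x - p) (q - x)"
    then have y': "p < y" "y < q" by auto
    show "F y integrable_on {0..t}"
      using y' pq t by (intro integrable_continuous_real cont_F_t) auto
    assume s: "s \<in> {0..t}"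
    show "\<bar>F y s - F x s\<bar> \<le> (K + B * M) * \<bar>y - x\<bar>"
      by (rule lipschitz_of_deriv_bound[of p q "\<lambda>y. F y s" "\<lambda>y. uxx y s - u y s * ux y s"])
        (use pq y' s t le F_x in auto)
  qed (use pq x t F_x in auto)
  have "((\<lambda>s. uxx x s - u x s * ux x s) has_integral u x t - u x 0) {0..t}"
  proof (rule fundamental_theorem_of_calculus_interior[OF t(1)])
    show "continuous_on {0..t} (u x)" using x t by (intro cont_t) auto
  qed (use x t u_t in \<open>auto simp: has_real_derivative_iff_has_vector_derivative[symmetric]\<close>)
  then show ?thesis using D u_0[OF x] by (simp add: integral_unique)
qed

lemma P_t:
  assumes x: "0 < x" "x < b" and t: "0 < t" "t < T"
  shows "((\<lambda>s. P x s) has_real_derivative F x t) (at t)"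
proof -
  \<comment> \<open>Room beyond \<open>t\<close> turns the derivative within an interval into a
    two-sided one.\<close>
  define r where "r = (t + T) / 2"
  have r: "t < r" "r < T" using t by (auto simp: r_def)
  have "((\<lambda>s. P x s) has_real_derivative F x t) (at t within {0..r})"
    unfolding P_def using x t r by (intro integral_has_real_derivative cont_F_t) auto
  then show ?thesis using t r by (simp add: at_within_Icc_at)
qed

lemma cont_P_t:
  assumes "0 < x" "x < b" "t < T"
  shows "continuous_on {0..t} (P x)"
  unfolding P_def using assms by (intro indefinite_integral_continuous_1 integrable_continuous_real cont_F_t)

lemma P_0: "P x 0 = 0"
  by (simp add: P_def)

lemma \<phi>_x:
  assumes "0 < x" "x < b" "0 \<le> t" "t < T"
  shows "((\<lambda>y. \<phi> y t) has_real_derivative - (u x t * \<phi> x t / 2)) (at x)"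
  unfolding \<phi>_def using assms by (auto intro!: derivative_eq_intros P_x)

text \<open>The right-hand side is the same as in \<open>\<phi>_t\<close>: this is the heat equation
  for \<open>\<phi>\<close>.\<close>

lemma \<phi>_xx:
  assumes "0 < x" "x < b" "0 \<le> t" "t < T"
  shows "((\<lambda>y. - (u y t * \<phi> y t / 2)) has_real_derivative - (F x t * \<phi> x t / 2)) (at x)"
  using assms by (auto intro!: derivative_eq_intros \<phi>_x u_x simp: F_def field_simps power2_eq_square)

lemma \<phi>_t:
  assumes "0 < x" "x < b" "0 < t" "t < T"
  shows "((\<lambda>s. \<phi> x s) has_real_derivative - (F x t * \<phi> x t / 2)) (at t)"
  unfolding \<phi>_def using assms by (auto intro!: derivative_eq_intros P_t)

text \<open>The constant depends on \<open>M\<close>, \<open>B\<close> and \<open>T\<close> alone,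
  so two solutions with the same bounds share it.\<close>

definition "E = exp ((M + B\<^sup>2 / 2) * T / 2)"

lemma \<phi>_le:
  assumes "0 < x" "x < b" "0 \<le> t" "t < T"
  shows "\<bar>\<phi> x t\<bar> \<le> E"
  using P_le[OF assms] by (simp add: \<phi>_def E_def abs_le_iff)

lemma u\<phi>_le:
  assumes "0 < x" "x < b" "0 \<le> t" "t < T"
  shows "\<bar>u x t * \<phi> x t / 2\<bar> \<le> B * E / 2"
  using mult_mono[OF u_le[OF assms] \<phi>_le[OF assms]] B_nonneg by (simp add: abs_mult)

lemma F\<phi>_le:
  assumes "0 < x" "x < b" "0 \<le> t" "t < T"
  shows "\<bar>F x t * \<phi> x t / 2\<bar> \<le> (M + B\<^sup>2 / 2) * E / 2"
  using mult_mono[OF F_le[OF assms] \<phi>_le[OF assms]] M_nonneg by (simp add: abs_mult)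

lemma cont_\<phi>_t:
  assumes "0 < x" "x < b" "t < T"
  shows "continuous_on {0..t} (\<phi> x)"
  unfolding \<phi>_def using assms by (intro continuous_intros cont_P_t) auto

section \<open>Truncated Laplace transform of \<open>\<phi>\<close> and of its derivative in
  \<open>x\<close>\<close>

definition "G s \<tau> x = integral {0..\<tau>} (\<lambda>t. exp (- s * t) * \<phi> x t)"
definition "G1 s \<tau> x = integral {0..\<tau>} (\<lambda>t. exp (- s * t) * (- (u x t * \<phi> x t / 2)))"

lemma G_integrable:
  assumes "0 < x" "x < b" "\<tau> < T"
  shows "(\<lambda>t. exp (- s * t) * \<phi> x t) integrable_on {0..\<tau>}"
  using assms by (intro integrable_continuous_real continuous_intros cont_\<phi>_t)

lemma G1_integrable:
  assumes "0 < x" "x < b" "\<tau> < T"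
  shows "(\<lambda>t. exp (- s * t) * (- (u x t * \<phi> x t / 2))) integrable_on {0..\<tau>}"
  using assms by (intro integrable_continuous_real continuous_intros cont_\<phi>_t cont_t) auto

lemma G_x:
  assumes x: "0 < x" "x < b" and \<tau>: "\<tau> < T" and "s \<ge> 0"
  shows "((\<lambda>x. G s \<tau> x) has_real_derivative G1 s \<tau> x) (at x)"
  unfolding G_def G1_def
proof (rule integral_deriv_dominated[where d = "min x (b - x)" and C = "B * E / 2"])
  fix y t assume y: "\<bar>y - x\<bar> < min x (b - x)"
  then have y': "0 < y" "y < b" by auto
  then show "(\<lambda>t. exp (- s * t) * \<phi> y t) integrable_on {0..\<tau>}" using \<tau> by (rule G_integrable)
  assume t: "t \<in> {0..\<tau>}"
  show "\<bar>exp (- s * t) * \<phi> y t - exp (- s * t) * \<phi> x t\<bar> \<le> B * E / 2 * \<bar>y - x\<bar>"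
    by (intro exp_weight_le lipschitz_of_deriv_bound[of 0 b "\<lambda>x. \<phi> x t" "\<lambda>x. - (u x t * \<phi> x t / 2)"])
      (use y' x t \<tau> \<open>s \<ge> 0\<close> \<phi>_x u\<phi>_le in auto)
next
  fix t assume "t \<in> {0..\<tau>}"
  then show "((\<lambda>y. exp (- s * t) * \<phi> y t) has_real_derivative exp (- s * t) * (- (u x t * \<phi> x t / 2))) (at x)"
    using x \<tau> by (intro DERIV_cmult \<phi>_x) auto
qed (use x in auto)

text \<open>Apply the heat equation under the integral and integrate by parts in \<open>t\<close>.
  The term -1 comes from \<open>\<phi> x 0 = 1\<close> and cancels in the difference of two
  solutions.\<close>

lemma G1_x:
  assumes x: "0 < x" "x < b" and \<tau>: "0 \<le> \<tau>" "\<tau> < T" and "s \<ge> 0"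
  shows "((\<lambda>x. G1 s \<tau> x) has_real_derivative s * G s \<tau> x + exp (- s * \<tau>) * \<phi> x \<tau> - 1) (at x)"
proof -
  have D: "((\<lambda>x. G1 s \<tau> x) has_real_derivative
      integral {0..\<tau>} (\<lambda>t. exp (- s * t) * (- (F x t * \<phi> x t / 2)))) (at x)"
    unfolding G1_def
  proof (rule integral_deriv_dominated[where d = "min x (b - x)" and C = "(M + B\<^sup>2 / 2) * E / 2"
        and f = "\<lambda>x t. exp (- s * t) * (- (u x t * \<phi> x t / 2))"])
    fix y t assume y: "\<bar>y - x\<bar> < min x (b - x)"
    then have y': "0 < y" "y < b" by auto
    then show "(\<lambda>t. exp (- s * t) * (- (u y t * \<phi> y t / 2))) integrable_on {0..\<tau>}"
      using \<tau>(2) by (rule G1_integrable)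
    assume t: "t \<in> {0..\<tau>}"
    show "\<bar>exp (- s * t) * (- (u y t * \<phi> y t / 2)) - exp (- s * t) * (- (u x t * \<phi> x t / 2))\<bar>
        \<le> (M + B\<^sup>2 / 2) * E / 2 * \<bar>y - x\<bar>"
      by (intro exp_weight_le lipschitz_of_deriv_bound[of 0 b "\<lambda>x. - (u x t * \<phi> x t / 2)" "\<lambda>x. - (F x t * \<phi> x t / 2)"])
        (use y' x t \<tau> \<open>s \<ge> 0\<close> \<phi>_xx F\<phi>_le in auto)
  next
    fix t assume "t \<in> {0..\<tau>}"
    then show "((\<lambda>y. exp (- s * t) * (- (u y t * \<phi> y t / 2))) has_real_derivative
        exp (- s * t) * (- (F x t * \<phi> x t / 2))) (at x)"
      using x \<tau> by (intro DERIV_cmult \<phi>_xx) auto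
  qed (use x in auto)
  have "((\<lambda>t. exp (- s * t) * (- (F x t * \<phi> x t / 2)) - s * (exp (- s * t) * \<phi> x t))
      has_integral exp (- s * \<tau>) * \<phi> x \<tau> - exp (- s * 0) * \<phi> x 0) {0..\<tau>}"
  proof (rule fundamental_theorem_of_calculus_interior[OF \<tau>(1)])
    show "continuous_on {0..\<tau>} (\<lambda>t. exp (- s * t) * \<phi> x t)"
      using x \<tau> by (intro continuous_intros cont_\<phi>_t)
    fix t assume t: "t \<in> {0<..<\<tau>}"
    have "((\<lambda>t. exp (- s * t) * \<phi> x t) has_real_derivative
        exp (- s * t) * (- (F x t * \<phi> x t / 2)) - s * (exp (- s * t) * \<phi> x t)) (at t)"
      using x t \<tau> by (auto intro!: derivative_eq_intros \<phi>_t simp: algebra_simps)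
    then show "((\<lambda>t. exp (- s * t) * \<phi> x t) has_vector_derivative
        exp (- s * t) * (- (F x t * \<phi> x t / 2)) - s * (exp (- s * t) * \<phi> x t)) (at t)"
      by (simp add: has_real_derivative_iff_has_vector_derivative)
  qed
  from has_integral_add[OF this has_integral_mult_right[OF integrable_integral[OF G_integrable[OF x \<tau>(2), of s]], of s]]
  have "((\<lambda>t. exp (- s * t) * (- (F x t * \<phi> x t / 2))) has_integral
      exp (- s * \<tau>) * \<phi> x \<tau> - 1 + s * G s \<tau> x) {0..\<tau>}"
    by (simp add: G_def \<phi>_def P_0)
  from integral_unique[OF this] D show ?thesis by (simp add: add.commute add_diff_eq)
qed

end

section \<open>Unique continuation and the maximum principle\<close>

text \<open>Two solutions whose Cauchy data at \<open>x = 0\<close> agree in the limit sense for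
  almost every \<open>t\<close> are compared through the Laplace transforms of their Cole-Hopf
  functions.\<close>

lemma burgers_unique_continuation:
  assumes "burgers_strip b T B M u ux uxx" and "burgers_strip b T B M v vx vxx"
    and N: "negligible N"
    and lim: "\<And>t. 0 < t \<Longrightarrow> t < T \<Longrightarrow> t \<notin> N \<Longrightarrow> ((\<lambda>x. u x t - v x t) \<longlongrightarrow> 0) (at_right 0)"
    and lim_x: "\<And>t. 0 < t \<Longrightarrow> t < T \<Longrightarrow> t \<notin> N \<Longrightarrow> ((\<lambda>x. ux x t - vx x t) \<longlongrightarrow> 0) (at_right 0)"
    and x: "0 < x" "x < b" and t: "0 < t" "t < T"
  shows "u x t = v x t"
proof -
  interpret U: burgers_strip b T B M u ux uxx by fact
  interpret V: burgers_strip b T B M v vx vxx by fact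
  \<comment> \<open>The limits are given for \<open>t > 0\<close> only, so the endpoint 0 of the
    time integrals joins the exceptional set.\<close>
  have N': "negligible (insert 0 N)" using N by simp
  have near0: "eventually (\<lambda>x. 0 < x \<and> x < b) (at_right 0)"
    using U.b_pos by (auto simp: eventually_at_right_field)
  \<comment> \<open>The squares differ by \<open>(u x t - v x t) * (u x t + v x t)\<close>, a null
    function times a bounded one.\<close>
  have F_lim: "((\<lambda>x. U.F x t - V.F x t) \<longlongrightarrow> 0) (at_right 0)" if t: "0 < t" "t < T" "t \<notin> N" for t
  proof -
    have "((\<lambda>x. (u x t - v x t) * (u x t + v x t)) \<longlongrightarrow> 0) (at_right 0)"
    proof (rule Lim_null_comparison)
      have "norm ((u x t - v x t) * (u x t + v x t)) \<le> \<bar>u x t - v x t\<bar> * (2 * B)" if "0 < x" "x < b" for x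
      proof -
        have "\<bar>u x t + v x t\<bar> \<le> 2 * B" using U.u_le[of x t] V.u_le[of x t] that t by auto
        then show ?thesis by (simp add: abs_mult mult_left_mono)
      qed
      then show "eventually (\<lambda>x. norm ((u x t - v x t) * (u x t + v x t)) \<le> \<bar>u x t - v x t\<bar> * (2 * B)) (at_right 0)"
        using near0 by (auto elim: eventually_mono)
      have "((\<lambda>x. \<bar>u x t - v x t\<bar> * (2 * B)) \<longlongrightarrow> \<bar>0\<bar> * (2 * B)) (at_right 0)"
        by (intro tendsto_intros lim t)
      then show "((\<lambda>x. \<bar>u x t - v x t\<bar> * (2 * B)) \<longlongrightarrow> 0) (at_right 0)" by simp
    qed
    then have "((\<lambda>x. (ux x t - vx x t) - (u x t - v x t) * (u x t + v x t) / 2) \<longlongrightarrow> 0 - 0 / 2) (at_right 0)"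
      by (intro tendsto_intros lim_x t) auto
    moreover have "(ux x t - vx x t) - (u x t - v x t) * (u x t + v x t) / 2 = U.F x t - V.F x t" for x
      by (simp add: U.F_def V.F_def field_simps power2_eq_square)
    ultimately show ?thesis by simp
  qed
  \<comment> \<open>Integration in time removes the exceptional set: from here on the limit holds
    for every \<open>t\<close>.\<close>
  have P_lim: "((\<lambda>x. U.P x t - V.P x t) \<longlongrightarrow> 0) (at_right 0)" if t: "0 \<le> t" "t < T" for t
  proof -
    have "((\<lambda>x. integral {0..t} (\<lambda>s. U.F x s - V.F x s)) \<longlongrightarrow> 0) (at_right 0)"
    proof (rule integral_tendsto_dominated_AE[OF U.b_pos _ _ N'])
      fix x assume x: "0 < x" "x < b"
      then show "(\<lambda>s. U.F x s - V.F x s) integrable_on {0..t}"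
        using t by (intro integrable_continuous_real continuous_intros U.cont_F_t V.cont_F_t)
      show "\<bar>U.F x s - V.F x s\<bar> \<le> 2 * (M + B\<^sup>2 / 2)" if "s \<in> {0..t}" for s
        using U.F_le[OF x, of s] V.F_le[OF x, of s] that t by auto
    qed (use F_lim t in auto)
    moreover have "integral {0..t} (\<lambda>s. U.F x s - V.F x s) = U.P x t - V.P x t" if "0 < x" "x < b" for x
      unfolding U.P_def V.P_def using that t
      by (intro Henstock_Kurzweil_Integration.integral_diff integrable_continuous_real U.cont_F_t V.cont_F_t)
    then have "eventually (\<lambda>x. integral {0..t} (\<lambda>s. U.F x s - V.F x s) = U.P x t - V.P x t) (at_right 0)"
      using near0 by (auto elim: eventually_mono)
    ultimately show ?thesis by (simp cong: tendsto_cong)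
  qed
  have \<phi>_lim: "((\<lambda>x. U.\<phi> x t - V.\<phi> x t) \<longlongrightarrow> 0) (at_right 0)" if t: "0 \<le> t" "t < T" for t
  proof (rule Lim_null_comparison)
    have "norm (U.\<phi> x t - V.\<phi> x t) \<le> V.E * \<bar>exp (- (U.P x t - V.P x t) / 2) - 1\<bar>" if "0 < x" "x < b" for x
    proof -
      have "U.\<phi> x t - V.\<phi> x t = V.\<phi> x t * (exp (- (U.P x t - V.P x t) / 2) - 1)"
        unfolding U.\<phi>_def V.\<phi>_def right_diff_distrib exp_add[symmetric] by (simp add: field_simps)
      then show ?thesis using V.\<phi>_le[OF that t] by (simp add: abs_mult mult_right_mono)
    qed
    then show "eventually (\<lambda>x. norm (U.\<phi> x t - V.\<phi> x t)
        \<le> V.E * \<bar>exp (- (U.P x t - V.P x t) / 2) - 1\<bar>) (at_right 0)"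
      using near0 by (auto elim: eventually_mono)
    have "((\<lambda>x. V.E * \<bar>exp (- (U.P x t - V.P x t) / 2) - 1\<bar>) \<longlongrightarrow> V.E * \<bar>exp (- 0 / 2) - 1\<bar>) (at_right 0)"
      by (intro tendsto_intros P_lim t) auto
    then show "((\<lambda>x. V.E * \<bar>exp (- (U.P x t - V.P x t) / 2) - 1\<bar>) \<longlongrightarrow> 0) (at_right 0)" by simp
  qed
  have u\<phi>_lim: "((\<lambda>x. u x t * U.\<phi> x t - v x t * V.\<phi> x t) \<longlongrightarrow> 0) (at_right 0)"
    if t: "0 < t" "t < T" "t \<notin> N" for t
  proof (rule Lim_null_comparison)
    have "norm (u x t * U.\<phi> x t - v x t * V.\<phi> x t)
        \<le> \<bar>u x t - v x t\<bar> * U.E + B * \<bar>U.\<phi> x t - V.\<phi> x t\<bar>" if "0 < x" "x < b" for x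
    proof -
      have eq: "u x t * U.\<phi> x t - v x t * V.\<phi> x t
          = (u x t - v x t) * U.\<phi> x t + v x t * (U.\<phi> x t - V.\<phi> x t)" by (simp add: algebra_simps)
      have "norm (u x t * U.\<phi> x t - v x t * V.\<phi> x t) \<le> \<bar>u x t - v x t\<bar> * \<bar>U.\<phi> x t\<bar> + \<bar>v x t\<bar> * \<bar>U.\<phi> x t - V.\<phi> x t\<bar>"
        unfolding eq real_norm_def abs_mult[symmetric] by (rule abs_triangle_ineq)
      also have "\<dots> \<le> \<bar>u x t - v x t\<bar> * U.E + B * \<bar>U.\<phi> x t - V.\<phi> x t\<bar>"
        by (rule add_mono[OF mult_left_mono[OF U.\<phi>_le] mult_right_mono[OF V.u_le]]) (use that t in simp_all)
      finally show ?thesis .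
    qed
    then show "eventually (\<lambda>x. norm (u x t * U.\<phi> x t - v x t * V.\<phi> x t)
        \<le> \<bar>u x t - v x t\<bar> * U.E + B * \<bar>U.\<phi> x t - V.\<phi> x t\<bar>) (at_right 0)"
      using near0 by (auto elim: eventually_mono)
    have "((\<lambda>x. \<bar>u x t - v x t\<bar> * U.E + B * \<bar>U.\<phi> x t - V.\<phi> x t\<bar>) \<longlongrightarrow> \<bar>0\<bar> * U.E + B * \<bar>0\<bar>) (at_right 0)"
      using t by (intro tendsto_intros lim \<phi>_lim) auto
    then show "((\<lambda>x. \<bar>u x t - v x t\<bar> * U.E + B * \<bar>U.\<phi> x t - V.\<phi> x t\<bar>) \<longlongrightarrow> 0) (at_right 0)" by simp
  qed
  \<comment> \<open>The difference of the transforms solves the linear equation with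
    \<open>\<mu> = sqrt n\<close> and a right-hand side of size \<open>exp (- n * \<tau>)\<close>;
    its Cauchy data vanish by dominated convergence.\<close>
  have G_bound: "\<bar>U.G (real n) \<tau> x - V.G (real n) \<tau> x\<bar>
      \<le> (exp (- real n * \<tau>) * (2 * U.E)) * b * exp (sqrt (real n) * b)"
    if n: "n \<ge> 1" and \<tau>: "0 \<le> \<tau>" "\<tau> < T" and x: "0 < x" "x < b" for n :: nat and \<tau> x
  proof (rule ode_zero_cauchy_data_bound[where x = x and g = "\<lambda>x. U.G (real n) \<tau> x - V.G (real n) \<tau> x"
        and ?g1.0 = "\<lambda>x. U.G1 (real n) \<tau> x - V.G1 (real n) \<tau> x"
        and R = "\<lambda>x. exp (- real n * \<tau>) * (U.\<phi> x \<tau> - V.\<phi> x \<tau>)"])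
    fix x assume x: "0 < x" "x < b"
    show "((\<lambda>x. U.G (real n) \<tau> x - V.G (real n) \<tau> x) has_real_derivative
        U.G1 (real n) \<tau> x - V.G1 (real n) \<tau> x) (at x)"
      using x \<tau> by (intro DERIV_diff U.G_x V.G_x) auto
    have "((\<lambda>x. U.G1 (real n) \<tau> x - V.G1 (real n) \<tau> x) has_real_derivative
        (real n * U.G (real n) \<tau> x + exp (- real n * \<tau>) * U.\<phi> x \<tau> - 1)
        - (real n * V.G (real n) \<tau> x + exp (- real n * \<tau>) * V.\<phi> x \<tau> - 1)) (at x)"
      using x \<tau> by (intro DERIV_diff U.G1_x V.G1_x) auto
    then show "((\<lambda>x. U.G1 (real n) \<tau> x - V.G1 (real n) \<tau> x) has_real_derivative
        (sqrt (real n))\<^sup>2 * (U.G (real n) \<tau> x - V.G (real n) \<tau> x)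
        + exp (- real n * \<tau>) * (U.\<phi> x \<tau> - V.\<phi> x \<tau>)) (at x)"
      by (rule DERIV_cong) (simp add: algebra_simps)
    have "\<bar>U.\<phi> x \<tau> - V.\<phi> x \<tau>\<bar> \<le> 2 * U.E"
      using U.\<phi>_le[OF x \<tau>] V.\<phi>_le[OF x \<tau>] unfolding U.E_def V.E_def by linarith
    then show "\<bar>exp (- real n * \<tau>) * (U.\<phi> x \<tau> - V.\<phi> x \<tau>)\<bar> \<le> exp (- real n * \<tau>) * (2 * U.E)"
      by (simp add: abs_mult)
  next
    have "((\<lambda>x. integral {0..\<tau>} (\<lambda>t. exp (- real n * t) * U.\<phi> x t - exp (- real n * t) * V.\<phi> x t)) \<longlongrightarrow> 0) (at_right 0)"
    proof (rule integral_tendsto_dominated_AE[OF U.b_pos _ _ negligible_empty])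
      fix x assume x: "0 < x" "x < b"
      show "(\<lambda>t. exp (- real n * t) * U.\<phi> x t - exp (- real n * t) * V.\<phi> x t) integrable_on {0..\<tau>}"
        by (intro integrable_diff U.G_integrable V.G_integrable x \<tau>)
      show "\<bar>exp (- real n * t) * U.\<phi> x t - exp (- real n * t) * V.\<phi> x t\<bar> \<le> 2 * U.E" if "t \<in> {0..\<tau>}" for t
        using U.\<phi>_le[OF x, of t] V.\<phi>_le[OF x, of t] that \<tau>
        by (intro exp_weight_le) (auto simp: U.E_def V.E_def)
    next
      fix t assume "t \<in> {0..\<tau>} - {}"
      then have "((\<lambda>x. exp (- real n * t) * (U.\<phi> x t - V.\<phi> x t)) \<longlongrightarrow> exp (- real n * t) * 0) (at_right 0)"
        using \<tau> by (intro tendsto_intros \<phi>_lim) auto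
      then show "((\<lambda>x. exp (- real n * t) * U.\<phi> x t - exp (- real n * t) * V.\<phi> x t) \<longlongrightarrow> 0) (at_right 0)"
        by (simp add: right_diff_distrib)
    qed
    moreover have "eventually (\<lambda>x. integral {0..\<tau>} (\<lambda>t. exp (- real n * t) * U.\<phi> x t - exp (- real n * t) * V.\<phi> x t)
        = U.G (real n) \<tau> x - V.G (real n) \<tau> x) (at_right 0)"
      using near0
    proof eventually_elim
      case (elim x)
      then show ?case
        unfolding U.G_def V.G_def using \<tau>
        by (intro Henstock_Kurzweil_Integration.integral_diff U.G_integrable V.G_integrable) auto
    qed
    ultimately show "((\<lambda>x. U.G (real n) \<tau> x - V.G (real n) \<tau> x) \<longlongrightarrow> 0) (at_right 0)"
      by (simp cong: tendsto_cong)
  next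
    have "((\<lambda>x. integral {0..\<tau>} (\<lambda>t. exp (- real n * t) * (- (u x t * U.\<phi> x t / 2))
        - exp (- real n * t) * (- (v x t * V.\<phi> x t / 2)))) \<longlongrightarrow> 0) (at_right 0)"
    proof (rule integral_tendsto_dominated_AE[OF U.b_pos _ _ N'])
      fix x assume x: "0 < x" "x < b"
      show "(\<lambda>t. exp (- real n * t) * (- (u x t * U.\<phi> x t / 2))
          - exp (- real n * t) * (- (v x t * V.\<phi> x t / 2))) integrable_on {0..\<tau>}"
        by (intro integrable_diff U.G1_integrable V.G1_integrable x \<tau>)
      show "\<bar>exp (- real n * t) * (- (u x t * U.\<phi> x t / 2))
          - exp (- real n * t) * (- (v x t * V.\<phi> x t / 2))\<bar> \<le> B * U.E" if "t \<in> {0..\<tau>}" for t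
        using U.u\<phi>_le[OF x, of t] V.u\<phi>_le[OF x, of t] that \<tau>
        by (intro exp_weight_le) (auto simp: U.E_def V.E_def)
    next
      fix t assume "t \<in> {0..\<tau>} - insert 0 N"
      then have "((\<lambda>x. exp (- real n * t) * (- (u x t * U.\<phi> x t - v x t * V.\<phi> x t) / 2))
          \<longlongrightarrow> exp (- real n * t) * (- 0 / 2)) (at_right 0)"
        using \<tau> by (intro tendsto_intros u\<phi>_lim) auto
      moreover have eq: "exp (- real n * t) * (- (u x t * U.\<phi> x t - v x t * V.\<phi> x t) / 2)
          = exp (- real n * t) * (- (u x t * U.\<phi> x t / 2)) - exp (- real n * t) * (- (v x t * V.\<phi> x t / 2))" for x
        by (simp add: algebra_simps diff_divide_distrib)
      ultimately show "((\<lambda>x. exp (- real n * t) * (- (u x t * U.\<phi> x t / 2))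
          - exp (- real n * t) * (- (v x t * V.\<phi> x t / 2))) \<longlongrightarrow> 0) (at_right 0)"
        unfolding eq by simp
    qed
    moreover have "eventually (\<lambda>x. integral {0..\<tau>} (\<lambda>t. exp (- real n * t) * (- (u x t * U.\<phi> x t / 2))
        - exp (- real n * t) * (- (v x t * V.\<phi> x t / 2)))
        = U.G1 (real n) \<tau> x - V.G1 (real n) \<tau> x) (at_right 0)"
      using near0
    proof eventually_elim
      case (elim x)
      then show ?case
        unfolding U.G1_def V.G1_def using \<tau>
        by (intro Henstock_Kurzweil_Integration.integral_diff U.G1_integrable V.G1_integrable) auto
    qed
    ultimately show "((\<lambda>x. U.G1 (real n) \<tau> x - V.G1 (real n) \<tau> x) \<longlongrightarrow> 0) (at_right 0)"
      by (simp cong: tendsto_cong)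
  qed (use n x U.b_pos in auto)
  define \<tau> where "\<tau> = (t + T) / 2"
  have \<tau>: "t < \<tau>" "0 \<le> \<tau>" "\<tau> < T" using t by (auto simp: \<tau>_def)
  have \<phi>_eq: "U.\<phi> x t = V.\<phi> x t" if x: "0 < x" "x < b" for x
  proof -
    have "U.\<phi> x t - V.\<phi> x t = 0"
    proof (rule mikusinski[of \<tau> "\<lambda>t. U.\<phi> x t - V.\<phi> x t"])
      show "continuous_on {0..\<tau>} (\<lambda>t. U.\<phi> x t - V.\<phi> x t)"
        by (intro continuous_intros U.cont_\<phi>_t V.cont_\<phi>_t x \<tau>)
      fix d assume d: "d < \<tau>"
      \<comment> \<open>\<open>\<delta>\<close> is the spare decay rate. Completing the square gives
        \<open>sqrt n * b \<le> n * \<delta> + b\<^sup>2 / (4 * \<delta>)\<close>, so the growth in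
        \<open>sqrt n\<close> is absorbed up to a constant independent of \<open>n\<close>.\<close>
      define \<delta> where "\<delta> = \<tau> - d"
      have "\<delta> > 0" using d by (simp add: \<delta>_def)
      have "\<bar>integral {0..\<tau>} (\<lambda>t. exp (- real n * t) * (U.\<phi> x t - V.\<phi> x t))\<bar>
          \<le> (2 * U.E * b * exp (b\<^sup>2 / (4 * \<delta>))) * exp (- real n * d)" if n: "n \<ge> 1" for n :: nat
      proof -
        have "integral {0..\<tau>} (\<lambda>t. exp (- real n * t) * (U.\<phi> x t - V.\<phi> x t))
            = U.G (real n) \<tau> x - V.G (real n) \<tau> x"
          unfolding U.G_def V.G_def right_diff_distrib
          by (intro Henstock_Kurzweil_Integration.integral_diff U.G_integrable V.G_integrable x \<tau>)
        then have "\<bar>integral {0..\<tau>} (\<lambda>t. exp (- real n * t) * (U.\<phi> x t - V.\<phi> x t))\<bar>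
            \<le> (exp (- real n * \<tau>) * (2 * U.E)) * b * exp (sqrt (real n) * b)"
          using G_bound[OF n \<tau>(2,3) x] by simp
        also have "\<dots> = 2 * U.E * b * exp (sqrt (real n) * b - real n * \<tau>)"
          by (simp add: exp_diff exp_minus field_simps)
        also have "\<dots> \<le> 2 * U.E * b * exp (b\<^sup>2 / (4 * \<delta>) - real n * d)"
        proof -
          have "0 \<le> (sqrt (real n) * (2 * \<delta>) - b)\<^sup>2" by simp
          also have "\<dots> = 4 * \<delta> * (real n * \<delta> + b\<^sup>2 / (4 * \<delta>) - sqrt (real n) * b)"
            using \<open>\<delta> > 0\<close> by (simp add: power2_diff power_mult_distrib field_simps power2_eq_square)
          finally have "sqrt (real n) * b \<le> real n * \<delta> + b\<^sup>2 / (4 * \<delta>)"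
            using \<open>\<delta> > 0\<close> by (simp add: zero_le_mult_iff)
          then have "sqrt (real n) * b - real n * \<tau> \<le> b\<^sup>2 / (4 * \<delta>) - real n * d"
            by (simp add: \<delta>_def algebra_simps)
          then show ?thesis
            using U.b_pos by (intro mult_left_mono) (auto simp: U.E_def)
        qed
        also have "\<dots> = (2 * U.E * b * exp (b\<^sup>2 / (4 * \<delta>))) * exp (- real n * d)"
          by (simp add: exp_diff exp_minus field_simps)
        finally show ?thesis .
      qed
      then show "\<exists>C. \<forall>n\<ge>1. \<bar>integral {0..\<tau>} (\<lambda>t. exp (- real n * t) * (U.\<phi> x t - V.\<phi> x t))\<bar> \<le> C * exp (- real n * d)"
        by blast
    qed (use t \<tau> in auto)
    then show ?thesis by simp
  qed
  \<comment> \<open>Equality of \<open>\<phi>\<close> on the whole interval gives equality of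
    \<open>P\<close>, and \<open>P\<close> has derivative \<open>u\<close> or \<open>v\<close> in
    \<open>x\<close>.\<close>
  have "((\<lambda>x. U.P x t) has_real_derivative v x t) (at x)"
  proof (rule has_field_derivative_transform_within_open[OF V.P_x[OF x]])
    show "V.P y t = U.P y t" if "y \<in> {0<..<b}" for y
      using \<phi>_eq[of y] that by (simp add: U.\<phi>_def V.\<phi>_def)
  qed (use x t in auto)
  moreover have "((\<lambda>x. U.P x t) has_real_derivative u x t) (at x)" using x t by (intro U.P_x) auto
  ultimately show ?thesis by (rule DERIV_unique[symmetric])
qed

text \<open>Burgers' equation is invariant under \<open>x\<close> to \<open>c - x\<close> together
  with \<open>u\<close> to \<open>- u\<close>. An interior point \<open>c\<close> thereby becomes
  the end where Cauchy data are prescribed.\<close>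

lemma (in burgers_strip) reflect:
  assumes c: "0 < c" "c \<le> b"
  shows "burgers_strip c T B M (\<lambda>x t. - u (c - x) t) (\<lambda>x t. ux (c - x) t) (\<lambda>x t. - uxx (c - x) t)"
proof
  have "continuous_on ({0<..<c} \<times> {0..<T}) (\<lambda>p. u (c - fst p) (snd p))"
    by (rule cont_compose) (use c in \<open>auto intro!: continuous_intros\<close>)
  then show "continuous_on ({0<..<c} \<times> {0..<T}) (\<lambda>(x, t). - u (c - x) t)"
    unfolding case_prod_unfold by (intro continuous_intros)
  have refl: "((\<lambda>y. f (c - y)) has_real_derivative - D) (at x)"
    if "(f has_real_derivative D) (at (c - x))" for f D x
  proof -
    have "((\<lambda>y. c - y) has_real_derivative - 1) (at x)" by (auto intro!: derivative_eq_intros)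
    then show ?thesis using DERIV_chain2[of f D "\<lambda>y. c - y" x "-1" UNIV, OF that] by simp
  qed
  fix x t assume x: "0 < x" "x < c"
  then have x': "0 < c - x" "c - x < b" using c by auto
  show "- u (c - x) 0 = 0" using u_0[OF x'] by simp
  {
    assume t: "0 < t" "t < T"
    show "((\<lambda>s. - u (c - x) s) has_real_derivative - uxx (c - x) t - - u (c - x) t * ux (c - x) t) (at t)"
      using x' t by (auto intro!: derivative_eq_intros u_t)
  }
  assume t: "0 \<le> t" "t < T"
  show "((\<lambda>y. - u (c - y) t) has_real_derivative ux (c - x) t) (at x)"
    using DERIV_minus[OF refl[OF u_x[OF x' t]]] by simp
  show "((\<lambda>y. ux (c - y) t) has_real_derivative - uxx (c - x) t) (at x)"
    by (rule refl[OF u_xx[OF x' t]])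
  show "\<bar>- u (c - x) t\<bar> \<le> B" using u_le[OF x' t] by simp
  show "\<bar>ux (c - x) t\<bar> \<le> M" using ux_le[OF x' t] .
qed (use c T_pos in auto)

text \<open>The weight \<open>exp (- t)\<close> makes the argument strict: at a positive maximum
  \<open>ux\<close> vanishes and \<open>uxx\<close> is at most 0, so the time derivative of
  \<open>w\<close> would be negative. The velocity \<open>c\<close> is kept separate from
  \<open>u\<close> so that \<open>- u\<close> can be treated with velocity \<open>u\<close>.\<close>

lemma burgers_max_principle:
  fixes u ux uxx :: "real \<Rightarrow> real \<Rightarrow> real"
  assumes cont: "continuous_on ({p..q} \<times> {0..\<tau>}) (\<lambda>(x, t). u x t)"
    and u_x: "\<And>x t. p < x \<Longrightarrow> x < q \<Longrightarrow> 0 < t \<Longrightarrow> t \<le> \<tau> \<Longrightarrow> ((\<lambda>y. u y t) has_real_derivative ux x t) (at x)"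
    and u_xx: "\<And>x t. p < x \<Longrightarrow> x < q \<Longrightarrow> 0 < t \<Longrightarrow> t \<le> \<tau> \<Longrightarrow> ((\<lambda>y. ux y t) has_real_derivative uxx x t) (at x)"
    and u_t: "\<And>x t. p < x \<Longrightarrow> x < q \<Longrightarrow> 0 < t \<Longrightarrow> t \<le> \<tau> \<Longrightarrow>
      ((\<lambda>s. u x s) has_real_derivative uxx x t - c x t * ux x t) (at t)"
    and bdry: "\<And>t. 0 \<le> t \<Longrightarrow> t \<le> \<tau> \<Longrightarrow> u p t \<le> 0" "\<And>t. 0 \<le> t \<Longrightarrow> t \<le> \<tau> \<Longrightarrow> u q t \<le> 0"
      "\<And>x. p \<le> x \<Longrightarrow> x \<le> q \<Longrightarrow> u x 0 \<le> 0"
    and x: "p \<le> x" "x \<le> q" and t: "0 \<le> t" "t \<le> \<tau>"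
  shows "u x t \<le> 0"
proof (rule ccontr)
  assume pos: "\<not> u x t \<le> 0"
  define w where "w x t = exp (- t) * u x t" for x t
  define S where "S = {p..q} \<times> {0..\<tau>}"
  have "continuous_on S (\<lambda>(x, t). w x t)"
    unfolding w_def S_def case_prod_unfold using cont unfolding case_prod_unfold
    by (intro continuous_intros)
  moreover have "compact S" unfolding S_def by (intro compact_Times) auto
  moreover have "S \<noteq> {}" using x t by (auto simp: S_def)
  ultimately obtain z where z: "z \<in> S" "\<And>y. y \<in> S \<Longrightarrow> (\<lambda>(x, t). w x t) y \<le> (\<lambda>(x, t). w x t) z"
    using continuous_attains_sup by metis
  obtain \<xi> \<sigma> where z_eq: "z = (\<xi>, \<sigma>)" by (cases z)
  have max: "w y s \<le> w \<xi> \<sigma>" if "p \<le> y" "y \<le> q" "0 \<le> s" "s \<le> \<tau>" for y s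
    using z(2)[of "(y, s)"] that by (simp add: z_eq S_def)
  have S: "p \<le> \<xi>" "\<xi> \<le> q" "0 \<le> \<sigma>" "\<sigma> \<le> \<tau>" using z(1) by (auto simp: z_eq S_def)
  have "0 < w x t" using pos by (simp add: w_def)
  then have wpos: "0 < w \<xi> \<sigma>" using max[OF x t] by linarith
  then have upos: "0 < u \<xi> \<sigma>" by (simp add: w_def zero_less_mult_iff)
  then have "\<xi> \<noteq> p" "\<xi> \<noteq> q" "\<sigma> \<noteq> 0" using bdry S by fastforce+
  then have int: "p < \<xi>" "\<xi> < q" "0 < \<sigma>" using S by auto
  define e where "e = min (\<xi> - p) (q - \<xi>)"
  have e: "e > 0" using int by (simp add: e_def)
  have dx: "((\<lambda>y. u y \<sigma>) has_real_derivative ux y \<sigma>) (at y)" if "\<bar>y - \<xi>\<bar> < e" for y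
    using that S int by (intro u_x) (auto simp: e_def)
  have mx: "u y \<sigma> \<le> u \<xi> \<sigma>" if "\<bar>y - \<xi>\<bar> < e" for y
    using max[of y \<sigma>] that S by (auto simp: e_def w_def)
  have ux0: "ux \<xi> \<sigma> = 0" and uxx0: "uxx \<xi> \<sigma> \<le> 0"
    using derivs_at_local_max[OF e dx u_xx mx] int S by auto
  have "((\<lambda>s. w \<xi> s) has_real_derivative
      exp (- \<sigma>) * (uxx \<xi> \<sigma> - c \<xi> \<sigma> * ux \<xi> \<sigma>) - exp (- \<sigma>) * u \<xi> \<sigma>) (at \<sigma>)"
    unfolding w_def using int S by (auto intro!: derivative_eq_intros u_t simp: algebra_simps)
  then have "0 \<le> exp (- \<sigma>) * (uxx \<xi> \<sigma> - c \<xi> \<sigma> * ux \<xi> \<sigma>) - exp (- \<sigma>) * u \<xi> \<sigma>"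
    by (rule deriv_nonneg_at_left_max[OF _ int(3)]) (use max S in auto)
  also have "\<dots> = exp (- \<sigma>) * (uxx \<xi> \<sigma> - u \<xi> \<sigma>)" using ux0 by (simp add: algebra_simps)
  finally show False using uxx0 upos by (simp add: zero_le_mult_iff)
qed

section \<open>Identification of the length\<close>

text \<open>Allowing \<open>b\<close> below \<open>\<Lambda>\<close> and using \<open>L\<close> in
  the bound puts solutions on intervals of different length into the same strip with the same
  constants. The bound \<open>M * L\<close> on \<open>u\<close> follows from the slope bound and the
  zero value at \<open>x = \<Lambda>\<close>.\<close>

lemma burgers_solution_imp_strip:
  assumes sol: "burgers_solution \<Lambda> T \<eta> (\<lambda>x. 0) u" and \<Lambda>: "0 < b" "b \<le> \<Lambda>" "\<Lambda> \<le> L" and "T > 0"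
    and M: "\<And>x t. 0 < x \<Longrightarrow> x < \<Lambda> \<Longrightarrow> 0 < t \<Longrightarrow> t < T \<Longrightarrow> \<bar>dx u x t\<bar> \<le> M" "M \<ge> 0"
  shows "burgers_strip b T (M * L) M u (dx u) (\<lambda>x t. deriv (\<lambda>y. dx u y t) x)"
proof
  have sol_at: "(\<lambda>y. u y t) differentiable (at x)" "(\<lambda>y. dx u y t) differentiable (at x)"
      "(\<lambda>s. u x s) differentiable (at t)"
      "dt u x t - deriv (\<lambda>y. dx u y t) x + u x t * dx u x t = 0"
    if "0 < x" "x < \<Lambda>" "0 < t" "t < T" for x t
    using sol that unfolding burgers_solution_def by blast+
  have cont: "continuous_on {(x, t). 0 < x \<and> x \<le> \<Lambda> \<and> 0 \<le> t \<and> t < T} (\<lambda>(x, t). u x t)"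
    and bdry: "\<And>t. 0 < t \<Longrightarrow> t < T \<Longrightarrow> u \<Lambda> t = 0" and init: "\<And>x. 0 < x \<Longrightarrow> x < \<Lambda> \<Longrightarrow> u x 0 = 0"
    using sol unfolding burgers_solution_def by blast+
  have deriv: "(f has_real_derivative deriv f x) (at x)" if "f differentiable (at x)" for f :: "real \<Rightarrow> real" and x
    using that by (metis DERIV_imp_deriv real_differentiableE)
  \<comment> \<open>The equation is posed for \<open>t > 0\<close>; at \<open>t = 0\<close> the
    derivatives in \<open>x\<close> come from the vanishing initial data.\<close>
  have zero: "(f has_real_derivative deriv f x) (at x) \<and> deriv f x = 0"
    if "\<And>y. 0 < y \<Longrightarrow> y < \<Lambda> \<Longrightarrow> f y = 0" "0 < x" "x < \<Lambda>" for f :: "real \<Rightarrow> real" and x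
  proof -
    have "(f has_real_derivative 0) (at x)"
      by (rule has_field_derivative_transform_within_open[of "\<lambda>_. 0" _ _ "{0<..<\<Lambda>}"]) (use that in auto)
    then show ?thesis by (metis DERIV_imp_deriv)
  qed
  have dx0: "dx u x 0 = 0" if "0 < x" "x < \<Lambda>" for x
    unfolding dx_def using zero[of "\<lambda>y. u y 0" x] init that by blast
  show "continuous_on ({0<..<b} \<times> {0..<T}) (\<lambda>(x, t). u x t)"
    by (rule continuous_on_subset[OF cont]) (use \<Lambda> in auto)
  fix x t :: real assume x: "0 < x" "x < b"
  then have x': "x < \<Lambda>" using \<Lambda> by simp
  show "u x 0 = 0" using init x x' by simp
  {
    assume t: "0 < t" "t < T"
    have "((\<lambda>s. u x s) has_real_derivative dt u x t) (at t)"
      unfolding dt_def by (rule deriv[OF sol_at(3)[OF x(1) x' t]])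
    then show "((\<lambda>s. u x s) has_real_derivative deriv (\<lambda>y. dx u y t) x - u x t * dx u x t) (at t)"
      by (rule DERIV_cong) (use sol_at(4)[OF x(1) x' t] in simp)
  }
  assume t: "0 \<le> t" "t < T"
  show "((\<lambda>y. u y t) has_real_derivative dx u x t) (at x)"
  proof (cases "t = 0")
    case True
    show ?thesis unfolding dx_def True using zero[of "\<lambda>y. u y 0" x] init x(1) x' by blast
  next
    case False
    then show ?thesis unfolding dx_def using deriv[OF sol_at(1)[of x t]] x x' t by simp
  qed
  show "((\<lambda>y. dx u y t) has_real_derivative deriv (\<lambda>y. dx u y t) x) (at x)"
  proof (cases "t = 0")
    case True
    show ?thesis unfolding True using zero[of "\<lambda>y. dx u y 0" x] dx0 x(1) x' by blast
  next
    case False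
    then show ?thesis using deriv[OF sol_at(2)[of x t]] x x' t by simp
  qed
  show "\<bar>dx u x t\<bar> \<le> M"
    using M(1)[of x t] M(2) dx0[of x] x x' t by (cases "t = 0") auto
  show "\<bar>u x t\<bar> \<le> M * L"
  proof (cases "t = 0")
    case True
    then show ?thesis using init x x' M(2) \<Lambda> by simp
  next
    case False
    then have t': "0 < t" "t < T" using t by auto
    have "continuous_on {x..\<Lambda>} (\<lambda>y. (\<lambda>(x, t). u x t) (y, t))"
      by (rule continuous_on_compose2[OF cont]) (use x t in \<open>auto intro!: continuous_intros\<close>)
    then have "continuous_on {x..\<Lambda>} (\<lambda>y. u y t)" by simp
    from MVT[OF x' this] obtain D z where z: "x < z" "z < \<Lambda>" "((\<lambda>y. u y t) has_real_derivative D) (at z)"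
      "u \<Lambda> t - u x t = (\<Lambda> - x) * D"
      using sol_at(1)[OF _ _ t'] x by fastforce
    have "D = dx u z t" unfolding dx_def using z(3) by (simp add: DERIV_imp_deriv)
    then have "\<bar>D\<bar> \<le> M" using M(1)[of z t] z x t' by simp
    then have "(\<Lambda> - x) * \<bar>D\<bar> \<le> L * M" using x x' \<Lambda> by (intro mult_mono) auto
    moreover have "u x t = - ((\<Lambda> - x) * D)" using z(4) bdry[OF t'] by simp
    then have "\<bar>u x t\<bar> = (\<Lambda> - x) * \<bar>D\<bar>" using x' by (simp add: abs_mult)
    ultimately show ?thesis by (simp add: mult.commute)
  qed
qed (use \<Lambda> \<open>T > 0\<close> in auto)

theorem theorem2p1:
  fixes T l L M :: real and \<eta> :: "real \<Rightarrow> real" and ul uL :: "real \<Rightarrow> real \<Rightarrow> real"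
  assumes "T > 0" and "0 < l" and "l \<le> L"
    and "Linfty_on T \<eta>" and "\<not> ae_zero_on T \<eta>"
    and "burgers_solution l T \<eta> (\<lambda>x. 0) ul"
    and "burgers_solution L T \<eta> (\<lambda>x. 0) uL"
    and "M > 0"
    and "\<forall>x t. 0 < x \<and> x < l \<and> 0 < t \<and> t < T \<longrightarrow> \<bar>dx ul x t\<bar> \<le> M"
    and "\<forall>x t. 0 < x \<and> x < L \<and> 0 < t \<and> t < T \<longrightarrow> \<bar>dx uL x t\<bar> \<le> M"
    and "\<forall>t. 0 < t \<and> t < T \<longrightarrow>
           (\<exists>c. ((\<lambda>x. dx ul x t) \<longlongrightarrow> c) (at_right 0) \<and> ((\<lambda>x. dx uL x t) \<longlongrightarrow> c) (at_right 0))"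
  shows "l = L"
proof (rule ccontr)
  assume "l \<noteq> L"
  then have lL: "l < L" using \<open>l \<le> L\<close> by simp
  \<comment> \<open>The times at which one of the two solutions fails to attain
    \<open>\<eta>\<close> at \<open>x = 0\<close>.\<close>
  define N where "N = {t. \<not> (t \<in> {0<..<T} \<longrightarrow> ((\<lambda>x. ul x t) \<longlongrightarrow> \<eta> t) (at_right 0) \<and> ((\<lambda>x. uL x t) \<longlongrightarrow> \<eta> t) (at_right 0))}"
  have "AE t in lebesgue. t \<in> {0<..<T} \<longrightarrow> ((\<lambda>x. ul x t) \<longlongrightarrow> \<eta> t) (at_right 0)"
    and AE_L: "AE t in lebesgue. t \<in> {0<..<T} \<longrightarrow> ((\<lambda>x. uL x t) \<longlongrightarrow> \<eta> t) (at_right 0)"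
    using assms(6,7) unfolding burgers_solution_def by blast+
  then have "AE t in lebesgue. t \<in> {0<..<T} \<longrightarrow> ((\<lambda>x. ul x t) \<longlongrightarrow> \<eta> t) (at_right 0) \<and> ((\<lambda>x. uL x t) \<longlongrightarrow> \<eta> t) (at_right 0)"
    by eventually_elim auto
  then obtain N' where "N \<subseteq> N'" "N' \<in> null_sets lebesgue"
    unfolding eventually_ae_filter N_def by auto
  then have N: "negligible N" using negligible_iff_null_sets negligible_subset by blast
  have lim: "((\<lambda>x. ul x t) \<longlongrightarrow> \<eta> t) (at_right 0)" "((\<lambda>x. uL x t) \<longlongrightarrow> \<eta> t) (at_right 0)"
    if "0 < t" "t < T" "t \<notin> N" for t
    using that by (auto simp: N_def)
  have strip_l: "burgers_strip l T (M * L) M ul (dx ul) (\<lambda>x t. deriv (\<lambda>y. dx ul y t) x)"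
    by (rule burgers_solution_imp_strip[OF assms(6)]) (use assms in auto)
  have strip_L: "burgers_strip b T (M * L) M uL (dx uL) (\<lambda>x t. deriv (\<lambda>y. dx uL y t) x)"
    if "0 < b" "b \<le> L" for b
    by (rule burgers_solution_imp_strip[OF assms(7)]) (use assms that in auto)
  interpret UL: burgers_strip L T "M * L" M uL "dx uL" "\<lambda>x t. deriv (\<lambda>y. dx uL y t) x"
    using strip_L[of L] assms by simp
  have eq: "ul x t = uL x t" if "0 < x" "x < l" "0 < t" "t < T" for x t
  proof (rule burgers_unique_continuation[OF strip_l strip_L[OF \<open>0 < l\<close> \<open>l \<le> L\<close>] N _ _ that])
    fix t assume t: "0 < t" "t < T" "t \<notin> N"
    show "((\<lambda>x. ul x t - uL x t) \<longlongrightarrow> 0) (at_right 0)"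
      using tendsto_diff[OF lim[OF t]] by simp
    obtain c where "((\<lambda>x. dx ul x t) \<longlongrightarrow> c) (at_right 0)" "((\<lambda>x. dx uL x t) \<longlongrightarrow> c) (at_right 0)"
      using assms(11) t by blast
    from tendsto_diff[OF this] show "((\<lambda>x. dx ul x t - dx uL x t) \<longlongrightarrow> 0) (at_right 0)" by simp
  qed
  have cont_l: "continuous_on {(x, t). 0 < x \<and> x \<le> l \<and> 0 \<le> t \<and> t < T} (\<lambda>(x, t). ul x t)"
    and bdry_l: "\<And>t. 0 < t \<Longrightarrow> t < T \<Longrightarrow> ul l t = 0"
    using assms(6) unfolding burgers_solution_def by blast+
  have cont_L: "continuous_on {(x, t). 0 < x \<and> x \<le> L \<and> 0 \<le> t \<and> t < T} (\<lambda>(x, t). uL x t)"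
    and bdry_L: "\<And>t. 0 < t \<Longrightarrow> t < T \<Longrightarrow> uL L t = 0"
    using assms(7) unfolding burgers_solution_def by blast+
  have cont_at: "((\<lambda>x. u x t) \<longlongrightarrow> u b t) (at_left b)"
    if "continuous_on {(x, t). 0 < x \<and> x \<le> b \<and> 0 \<le> t \<and> t < T} (\<lambda>(x, t). u x t)"
      and t: "0 \<le> t" "t < T" and "0 < b" for u :: "real \<Rightarrow> real \<Rightarrow> real" and b t
  proof -
    have "continuous_on {0<..b} (\<lambda>x. (\<lambda>(x, t). u x t) (x, t))"
      by (rule continuous_on_compose2[OF that(1)]) (use t in \<open>auto intro!: continuous_intros\<close>)
    then have "((\<lambda>x. u x t) \<longlongrightarrow> u b t) (at b within {0<..b})"
      using \<open>0 < b\<close> by (simp add: continuous_on_def)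
    moreover have "at b within {0<..b} = at_left b"
      by (rule at_within_nhd[of _ "{0<..}"]) (use \<open>0 < b\<close> in auto)
    ultimately show ?thesis by simp
  qed
  have near: "eventually (\<lambda>x. 0 < x \<and> x < b) (at_left b)" if "0 < b" for b :: real
    using that by (auto simp: eventually_at_left_field)
  \<comment> \<open>\<open>uL\<close> agrees with \<open>ul\<close> to the left of \<open>l\<close>;
    continuity up to \<open>x = l\<close> carries over the boundary value of
    \<open>ul\<close>.\<close>
  have zero_l: "uL l t = 0" if t: "0 < t" "t < T" for t
  proof -
    have "((\<lambda>x. uL x t) \<longlongrightarrow> uL l t) (at_left l)"
      using t assms(1-3)
      by (intro cont_at continuous_on_subset[OF cont_L]) auto
    moreover have "((\<lambda>x. uL x t) \<longlongrightarrow> ul l t) (at_left l)"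
    proof (rule Lim_transform_eventually)
      show "((\<lambda>x. ul x t) \<longlongrightarrow> ul l t) (at_left l)"
        using t \<open>0 < l\<close> by (intro cont_at[OF cont_l]) auto
      show "eventually (\<lambda>x. ul x t = uL x t) (at_left l)"
        using near[OF \<open>0 < l\<close>] by (rule eventually_mono) (use t eq in auto)
    qed
    ultimately show ?thesis
      using bdry_l[OF t] by (metis tendsto_unique trivial_limit_at_left_real)
  qed
  \<comment> \<open>At the corner \<open>t = 0\<close> neither the initial nor the boundary
    condition applies, so continuity along the initial line supplies the value.\<close>
  have zero_L: "uL L t = 0" if t: "0 \<le> t" "t < T" for t
  proof (cases "t = 0")
    case True
    have "((\<lambda>x. uL x 0) \<longlongrightarrow> uL L 0) (at_left L)"
      using assms(1) lL \<open>0 < l\<close> by (intro cont_at[OF cont_L]) auto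
    moreover have "((\<lambda>x. uL x 0) \<longlongrightarrow> 0) (at_left L)"
      using near[OF UL.b_pos] UL.u_0 by (intro tendsto_eventually) (auto elim: eventually_mono)
    ultimately show ?thesis using True by (metis tendsto_unique trivial_limit_at_left_real)
  qed (use bdry_L t in auto)
  have right_zero: "uL x t = 0" if x: "l \<le> x" "x \<le> L" and t: "0 \<le> t" "t < T" for x t
  proof -
    have bdry: "uL l s = 0" "uL L s = 0" if "0 \<le> s" "s \<le> t" for s
      using zero_l[of s] zero_L[of s] UL.u_0[of l] that t lL \<open>0 < l\<close> by (cases "s = 0"; simp)+
    have init: "uL y 0 = 0" if "l \<le> y" "y \<le> L" for y
      using UL.u_0[of y] zero_L[of 0] that \<open>0 < l\<close> \<open>T > 0\<close> by (cases "y = L") auto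
    have cont: "continuous_on ({l..L} \<times> {0..t}) (\<lambda>(x, t). uL x t)"
      by (rule continuous_on_subset[OF cont_L]) (use t \<open>0 < l\<close> in auto)
    have "uL x t \<le> 0"
      by (rule burgers_max_principle[OF cont, where ux = "dx uL" and c = uL
            and uxx = "\<lambda>x t. deriv (\<lambda>y. dx uL y t) x"])
        (use x t \<open>0 < l\<close> bdry init UL.u_x UL.u_xx UL.u_t in auto)
    moreover have "- uL x t \<le> 0"
    proof (rule burgers_max_principle[where u = "\<lambda>x t. - uL x t" and ux = "\<lambda>x t. - dx uL x t" and c = uL
          and uxx = "\<lambda>x t. - deriv (\<lambda>y. dx uL y t) x"])
      show "continuous_on ({l..L} \<times> {0..t}) (\<lambda>(x, t). - uL x t)"
        using continuous_on_minus[OF cont] by (simp add: case_prod_unfold)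
      fix y s assume y: "l < y" "y < L" and s: "0 < s" "s \<le> t"
      then have y': "0 < y" and s': "s < T" "0 \<le> s" using \<open>0 < l\<close> t by auto
      show "((\<lambda>y. - uL y s) has_real_derivative - dx uL y s) (at y)"
        by (intro DERIV_minus UL.u_x y y' s')
      show "((\<lambda>y. - dx uL y s) has_real_derivative - deriv (\<lambda>y. dx uL y s) y) (at y)"
        by (intro DERIV_minus UL.u_xx y y' s')
      show "((\<lambda>s. - uL y s) has_real_derivative
          - deriv (\<lambda>y. dx uL y s) y - uL y s * - dx uL y s) (at s)"
        by (rule DERIV_cong[OF DERIV_minus[OF UL.u_t[OF y' y(2) s(1) s'(1)]]]) simp
    qed (use x t bdry init in auto)
    ultimately show ?thesis by simp
  qed
  \<comment> \<open>A point inside \<open>(l, L)\<close>, around which \<open>uL\<close> vanishes.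
    After reflection it is the left end of the strip and the Cauchy data there are zero, so
    comparison with the zero solution \<open>Z\<close> reaches back to the original boundary
    \<open>x = 0\<close>.\<close>
  define c where "c = (l + L) / 2"
  have c: "l < c" "c < L" "0 < c" using lL \<open>0 < l\<close> by (auto simp: c_def)
  interpret R: burgers_strip c T "M * L" M "\<lambda>x t. - uL (c - x) t" "\<lambda>x t. dx uL (c - x) t"
      "\<lambda>x t. - deriv (\<lambda>y. dx uL y t) (c - x)"
    by (rule UL.reflect) (use c in auto)
  interpret Z: burgers_strip c T "M * L" M "\<lambda>x t. 0" "\<lambda>x t. 0" "\<lambda>x t. 0"
    using R.B_nonneg R.M_nonneg c \<open>T > 0\<close> by unfold_locales auto
  have left_zero: "uL x t = 0" if x: "0 < x" "x < c" and t: "0 < t" "t < T" for x t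
  proof -
    have "- uL (c - (c - x)) t = 0"
    proof (rule burgers_unique_continuation[OF R.burgers_strip_axioms Z.burgers_strip_axioms negligible_empty])
      fix t assume t: "0 < t" "t < T"
      have near0: "eventually (\<lambda>x. 0 < x \<and> x < c - l) (at_right 0)"
        unfolding eventually_at_right_field using c by (intro exI[of _ "c - l"]) auto
      have "uL (c - x) t = 0" if "0 < x \<and> x < c - l" for x
        using right_zero[of "c - x" t] that t c by auto
      then show "((\<lambda>x. - uL (c - x) t - 0) \<longlongrightarrow> 0) (at_right 0)"
        using near0 by (intro tendsto_eventually) (auto elim: eventually_mono)
      have "dx uL (c - x) t = 0" if x: "0 < x \<and> x < c - l" for x
      proof (rule DERIV_unique)
        show "((\<lambda>y. uL y t) has_real_derivative dx uL (c - x) t) (at (c - x))"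
          using x t c \<open>0 < l\<close> by (intro UL.u_x) auto
        \<comment> \<open>The point \<open>c - x\<close> lies in the open interval
          \<open>(l, L)\<close>, where \<open>uL\<close> is identically zero.\<close>
        show "((\<lambda>y. uL y t) has_real_derivative 0) (at (c - x))"
          by (rule has_field_derivative_transform_within_open[of "\<lambda>_. 0" _ _ "{l<..<L}"])
            (use x t c right_zero in auto)
      qed
      then show "((\<lambda>x. dx uL (c - x) t - 0) \<longlongrightarrow> 0) (at_right 0)"
        using near0 by (intro tendsto_eventually) (auto elim: eventually_mono)
    qed (use x t in auto)
    then show ?thesis by simp
  qed
  \<comment> \<open>\<open>uL\<close> vanishes next to \<open>x = 0\<close>, so its boundary limit
    \<open>\<eta> t\<close> is 0 wherever it is attained, which contradicts the assumption on
    \<open>\<eta>\<close>.\<close>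
  have "\<eta> t = 0" if "0 < t" "t < T" "((\<lambda>x. uL x t) \<longlongrightarrow> \<eta> t) (at_right 0)" for t
  proof -
    have "eventually (\<lambda>x. uL x t = 0) (at_right 0)"
      unfolding eventually_at_right_field using c left_zero that by blast
    then have "((\<lambda>x. uL x t) \<longlongrightarrow> 0) (at_right 0)" by (rule tendsto_eventually)
    then show ?thesis using that(3) tendsto_unique trivial_limit_at_right_real by blast
  qed
  then have "ae_zero_on T \<eta>"
    unfolding ae_zero_on_def using AE_L by (auto elim!: eventually_mono)
  then show False using assms(5) by simp
qed

end
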